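(* Let $\mu$ be a law on $\mathbb{R}$ that is centered, different from $\delta_0$, and admits finite exponential moments, i.e. $\int e^{tx}\,\mu(dx)<\infty$ for all $t$ in a neighbourhood of $0$. Let $\vartheta^2\in(0,\infty)$ be its variance. Then, as $J\to\infty$, $$F_{\mu}(J)=\frac{\vartheta^2}{2J}+O\left(\frac{(\log J)^{1/3}}{J^{4/3}}\right).$$
   Context: Let $\mathbb{N}=\{1,2,\dots\}$. For a law $\mu$ on $\mathbb{R}$ with finite first moment, let $h=(h_n)_{n\in\mathbb{N}}$ be, under $\mathbb{P}_\mu$, an i.i.d. sequence of real random variables with law $\mu$. For $N\in\mathbb{N}$, $(a,b)\in\{-1,+1\}^2$ and real $J$, the partition function of the Ising chain with external field $h$ is $$Z_{N,h}^{a,b}(J):=\sum_{\substack{\sigma\in\{-1,1\}^{\{0,1,\dots,N\}}\\ \sigma_0=a,\ \sigma_N=b}}\exp\Big(-2J\sum_{n=1}^N\mathbf 1_{\{\sigma_n\ne\sigma_{n-1}\}}+\sum_{n=1}^N\sigma_nh_n\Big).$$ The free energy density $F_\mu(J)$ is the deterministic real number such that, $\mathbb{P}_\mu$-almost surely, for every $(a,b)\in\{-1,+1\}^2$, $\frac1N\log Z_{N,h}^{a,b}(J)\to F_\mu(J)$ as $N\to\infty$ (this limit exists by Kingman's subadditive ergodic theorem). *)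

theory Defs
  imports "HOL-Probability.Probability"
begin

definition ising_Z :: "nat \<Rightarrow> (nat \<Rightarrow> real) \<Rightarrow> real \<Rightarrow> real \<Rightarrow> real \<Rightarrow> real" where
  "ising_Z N h a b J =
     (\<Sum>\<sigma> | \<sigma> \<in> {0..N} \<rightarrow>\<^sub>E {-1, 1} \<and> \<sigma> 0 = a \<and> \<sigma> N = b.
        exp (- 2 * J * (\<Sum>n=1..N. of_bool (\<sigma> n \<noteq> \<sigma> (n - 1))) + (\<Sum>n=1..N. \<sigma> n * h n)))"

text \<open>
  The law of the i.i.d. field is the infinite product of \<^term>\<open>\<mu>\<close> over the positive integers.
  The limit is unique if it exists; its existence is not assumed anywhere, so it has to be
  established before anything can be concluded about the description operator.
\<close>

definition free_energy :: "real measure \<Rightarrow> real \<Rightarrow> real" where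
  "free_energy \<mu> J =
     (THE F. AE h in (\<Pi>\<^sub>M n\<in>{1::nat..}. \<mu>).
        \<forall>a\<in>{-1, 1}. \<forall>b\<in>{-1, 1}. (\<lambda>N. 1 / real N * ln (ising_Z N h a b J)) \<longlonglongrightarrow> F)"

end

theory Submission imports Defs begin

text \<open>
  With \<open>e = exp (- 2 * J)\<close>, the partition functions are the entries of products of the random
  matrices \<open>diag (exp h, exp (- h)) [[1, e], [e, 1]]\<close>. The logarithm of the total mass of such a
  product is additive over concatenated blocks up to a constant depending only on \<open>J\<close>, so the strong
  law of large numbers for i.i.d. blocks yields the free energy as the limit of expectations.

  For the vector \<open>(P, Q)\<close> started at \<open>(1, 1)\<close>, put \<open>L = ln P - ln Q\<close>, \<open>A = (ln P + ln Q) / 2\<close>,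
  \<open>a = ln (1 + exp (- L - 2 * J))\<close> and \<open>b = ln (1 + exp (L - 2 * J))\<close>. One step changes \<open>L\<close> by
  \<open>2 * h + a - b\<close> and \<open>A\<close> by \<open>(a + b) / 2\<close>: the walk \<open>L\<close> is reflected softly at \<open>- 2 * J\<close> and
  \<open>2 * J\<close>, and \<open>A\<close> records half of its local time there. As \<open>L * (a - b)\<close> is
  \<open>- 2 * J * (a + b)\<close> up to boundary terms while \<open>L\<close> has bounded second moment, expanding \<open>L\<^sup>2\<close> over
  many steps shows that the mean of \<open>a + b\<close> per step is the variance divided by \<open>J\<close>. The boundary
  terms are controlled by the overshoot \<open>2 * \<bar>h\<bar>\<close>; this even gives the error \<open>O(J powr (- 3 / 2))\<close>.
\<close>

section \<open>Transfer matrices\<close>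

text \<open>The components are the weights of chains ending in spin 1 and in spin -1. The step to
  \<open>Suc n\<close> first mixes them by \<open>e\<close> and then applies the field at
  \<open>Suc n\<close>, so n steps read exactly the sites 1 to n.\<close>

primrec transfer :: "real \<Rightarrow> (nat \<Rightarrow> real) \<Rightarrow> real \<times> real \<Rightarrow> nat \<Rightarrow> real \<times> real" where
  "transfer e h v 0 = v"
| "transfer e h v (Suc n) =
     (exp (h (Suc n)) * (fst (transfer e h v n) + e * snd (transfer e h v n)),
      exp (- h (Suc n)) * (e * fst (transfer e h v n) + snd (transfer e h v n)))"

lemma transfer_add:
  "transfer e h v (m + n) = transfer e (\<lambda>k. h (m + k)) (transfer e h v m) n"
  by (induction n) simp_all

lemma transfer_scale:
  "transfer e h (c * p, c * q) n = (c * fst (transfer e h (p, q) n), c * snd (transfer e h (p, q) n))"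
  by (induction n) (simp_all add: algebra_simps)

lemma transfer_mono:
  assumes "0 \<le> e" "fst v \<le> fst w" "snd v \<le> snd w"
  shows "fst (transfer e h v n) \<le> fst (transfer e h w n) \<and>
         snd (transfer e h v n) \<le> snd (transfer e h w n)"
  using assms by (induction n) (auto intro!: mult_left_mono add_mono)

lemma transfer_pos:
  assumes "0 \<le> e" "0 < fst v" "0 < snd v"
  shows "0 < fst (transfer e h v n) \<and> 0 < snd (transfer e h v n)"
  using assms
proof (induction n)
  case (Suc n)
  then have "0 < fst (transfer e h v n)" "0 < snd (transfer e h v n)" by auto
  moreover from this have "0 \<le> e * fst (transfer e h v n)" "0 \<le> e * snd (transfer e h v n)"
    using Suc.prems by auto
  ultimately show ?case by (auto intro!: mult_pos_pos simp del: zero_le_mult_iff)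
qed simp

lemma borel_measurable_transfer:
  assumes "\<And>k. k \<in> {1..n} \<Longrightarrow> (\<lambda>x. H x k) \<in> borel_measurable M"
  shows "(\<lambda>x. fst (transfer e (H x) v n)) \<in> borel_measurable M \<and>
         (\<lambda>x. snd (transfer e (H x) v n)) \<in> borel_measurable M"
  using assms
proof (induction n)
  case (Suc n)
  then have [measurable]: "(\<lambda>x. fst (transfer e (H x) v n)) \<in> borel_measurable M"
    "(\<lambda>x. snd (transfer e (H x) v n)) \<in> borel_measurable M"
    "(\<lambda>x. H x (Suc n)) \<in> borel_measurable M"
    by auto
  show ?case by simp
qed simp

section \<open>Partition functions as entries of matrix products\<close>

lemma ising_Z_0: "a \<in> {-1, 1} \<Longrightarrow> ising_Z 0 h a b J = of_bool (a = b)"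
proof -
  assume a: "a \<in> {-1, 1}"
  have "{\<sigma>. \<sigma> \<in> {0..0::nat} \<rightarrow>\<^sub>E {-1, 1} \<and> \<sigma> 0 = a \<and> \<sigma> 0 = b} =
      (if a = b then {\<lambda>n\<in>{0}. a} else {})"
    using a by (auto simp: PiE_def extensional_def fun_eq_iff)
  then show ?thesis
    by (simp add: ising_Z_def)
qed

text \<open>Configurations are split according to the spin c at site N: the new spin b contributes
  its field factor and, if it differs from c, the cost of one domain wall.\<close>

lemma ising_Z_Suc:
  assumes b: "b \<in> {-1, 1::real}"
  shows "ising_Z (Suc N) h a b J =
    exp (b * h (Suc N)) * (\<Sum>c\<in>{-1, 1}. exp (- 2 * J * of_bool (b \<noteq> c)) * ising_Z N h a c J)"
proof -
  define S where "S = (\<lambda>(N::nat) c. {\<sigma>. \<sigma> \<in> {0..N} \<rightarrow>\<^sub>E {-1, 1::real} \<and> \<sigma> 0 = a \<and> \<sigma> N = c})"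
  define W where "W = (\<lambda>N (\<sigma>::nat \<Rightarrow> real). exp (- 2 * J * (\<Sum>n=1..N. of_bool (\<sigma> n \<noteq> \<sigma> (n - 1)))
      + (\<Sum>n=1..N. \<sigma> n * h n)))"
  have Z: "ising_Z N h a c J = sum (W N) (S N c)" for N c
    by (simp add: ising_Z_def S_def W_def)
  have fin: "finite (S N c)" for N c
    by (rule finite_subset[of _ "{0..N} \<rightarrow>\<^sub>E {-1, 1}"]) (auto simp: S_def intro!: finite_PiE)
  have Wupd: "W (Suc N) (\<sigma>(Suc N := b)) =
      exp (b * h (Suc N)) * (exp (- 2 * J * of_bool (b \<noteq> c)) * W N \<sigma>)" if "\<sigma> \<in> S N c" for \<sigma> c
  proof -
    have "\<sigma> N = c" using that by (simp add: S_def)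
    then have "(\<Sum>n=1..Suc N. of_bool ((\<sigma>(Suc N := b)) n \<noteq> (\<sigma>(Suc N := b)) (n - 1)) :: real)
       = (\<Sum>n=1..N. of_bool (\<sigma> n \<noteq> \<sigma> (n - 1))) + of_bool (b \<noteq> c)"
      unfolding sum.cl_ivl_Suc by (auto intro!: sum.cong simp del: sum_of_bool_eq)
    moreover have "(\<Sum>n=1..Suc N. (\<sigma>(Suc N := b)) n * h n) = (\<Sum>n=1..N. \<sigma> n * h n) + b * h (Suc N)"
      unfolding sum.cl_ivl_Suc by (auto intro!: sum.cong)
    ultimately show ?thesis
      unfolding W_def by (simp only: exp_add[symmetric]) (simp only: algebra_simps)
  qed
  have "sum (W (Suc N)) (S (Suc N) b) = (\<Sum>\<sigma>\<in>(\<Union>c\<in>{-1,1}. S N c). W (Suc N) (\<sigma>(Suc N := b)))"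
  \<comment> \<open>Configurations are extensional functions, so removing the last spin means
    resetting the value at \<open>Suc N\<close> to \<open>undefined\<close>; the inverse map writes
    b there.\<close>
  proof (rule sum.reindex_bij_witness[of _ "\<lambda>\<sigma>. \<sigma>(Suc N := b)" "\<lambda>\<sigma>. \<sigma>(Suc N := undefined)"])
    fix \<sigma> assume "\<sigma> \<in> S (Suc N) b"
    then show "\<sigma>(Suc N := undefined) \<in> (\<Union>c\<in>{- 1, 1}. S N c)"
      by (auto simp: S_def PiE_def extensional_def Pi_def)
  next
    fix \<sigma> assume *: "\<sigma> \<in> (\<Union>c\<in>{- 1, 1}. S N c)"
    then have "\<sigma> (Suc N) = undefined"
      by (auto simp: S_def PiE_def extensional_def)
    then show "\<sigma>(Suc N := b, Suc N := undefined) = \<sigma>" by auto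
    show "\<sigma>(Suc N := b) \<in> S (Suc N) b"
      using * b by (auto simp: S_def PiE_def extensional_def Pi_def le_Suc_eq)
  qed (auto simp: S_def)
  also have "\<dots> = (\<Sum>c\<in>{-1,1}. \<Sum>\<sigma>\<in>S N c. W (Suc N) (\<sigma>(Suc N := b)))"
    by (rule sum.UNION_disjoint) (auto simp: fin, auto simp: S_def)
  also have "\<dots> = (\<Sum>c\<in>{-1,1}. \<Sum>\<sigma>\<in>S N c.
      exp (b * h (Suc N)) * (exp (- 2 * J * of_bool (b \<noteq> c)) * W N \<sigma>))"
    by (intro sum.cong refl Wupd)
  also have "\<dots> = exp (b * h (Suc N)) * (\<Sum>c\<in>{-1, 1}. exp (- 2 * J * of_bool (b \<noteq> c)) * sum (W N) (S N c))"
    by (simp only: sum_distrib_left)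
  finally show ?thesis by (simp add: Z)
qed

text \<open>The left boundary spin selects the initial unit vector, the right one selects the
  component. Spin 0 bears no field, in agreement with a product whose first matrix belongs to site
  1.\<close>

lemma ising_Z_eq_transfer:
  assumes "a \<in> {-1, 1}"
  shows "transfer (exp (- 2 * J)) h (of_bool (a = 1), of_bool (a = -1)) N =
         (ising_Z N h a 1 J, ising_Z N h a (-1) J)"
proof (induction N)
  case 0
  show ?case using assms by (auto simp: ising_Z_0)
next
  case (Suc N)
  show ?case by (simp only: transfer.simps Suc) (simp add: ising_Z_Suc algebra_simps)
qed

section \<open>Near additivity of the logarithm of the total mass\<close>

text \<open>By linearity, for \<open>e = exp (- 2 * J)\<close> this is the logarithm of the sum of
  the partition functions over all four pairs of boundary spins.\<close>

definition log_total :: "real \<Rightarrow> nat \<Rightarrow> (nat \<Rightarrow> real) \<Rightarrow> real" where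
  "log_total e n h = ln (fst (transfer e h (1, 1) n) + snd (transfer e h (1, 1) n))"

text \<open>The vector (p, q) lies coordinatewise below p + q times (1, 1), and the transfer
  matrices preserve this order.\<close>

lemma transfer_le_total:
  assumes "0 \<le> e" "0 \<le> p" "0 \<le> q"
  shows "fst (transfer e h (p, q) n) \<le> (p + q) * fst (transfer e h (1, 1) n) \<and>
         snd (transfer e h (p, q) n) \<le> (p + q) * snd (transfer e h (1, 1) n)"
  using transfer_mono[of e "(p, q)" "((p + q) * 1, (p + q) * 1)" h n] assms
  by (simp add: transfer_scale[of e h "p + q" 1 1 n, simplified])

text \<open>One application of the transfer matrix makes the two entries comparable up to the factor \<open>e\<close>.\<close>

lemma transfer_ge_total:
  assumes e: "0 < e" "e \<le> 1" and v: "0 \<le> p" "0 \<le> q" and n: "0 < n"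
  defines "c \<equiv> e / (1 + e) * (p + q)"
  shows "c * fst (transfer e h (1, 1) n) \<le> fst (transfer e h (p, q) n) \<and>
         c * snd (transfer e h (1, 1) n) \<le> snd (transfer e h (p, q) n)"
proof -
  obtain m where m: "n = 1 + m" using n by (metis Suc_eq_plus1_left not0_implies_Suc not_gr0)
  \<comment> \<open>The constant c is chosen so that c (1 + e) = e (p + q), a lower bound for both
    mixed coordinates p + e q and e p + q. From the second matrix on, monotonicity suffices.\<close>
  have "c * (1 + e) = e * (p + q)" using e by (simp add: c_def)
  moreover have "e * p \<le> p" "e * q \<le> q"
    using mult_right_mono[OF e(2)] v by auto
  ultimately have c1: "c * (1 + e) \<le> p + e * q" "c * (1 + e) \<le> e * p + q"
    by (auto simp: algebra_simps)
  have "transfer e h (c * 1, c * 1) n = transfer e (\<lambda>k. h (1 + k)) (transfer e h (c, c) 1) m"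
    unfolding m transfer_add by simp
  moreover have "transfer e h (p, q) n = transfer e (\<lambda>k. h (1 + k)) (transfer e h (p, q) 1) m"
    unfolding m transfer_add by simp
  moreover have "fst (transfer e h (c, c) 1) \<le> fst (transfer e h (p, q) 1)"
    "snd (transfer e h (c, c) 1) \<le> snd (transfer e h (p, q) 1)"
    using mult_left_mono[OF c1(1), of "exp (h 1)"] mult_left_mono[OF c1(2), of "exp (- h 1)"]
    by (simp_all add: algebra_simps)
  ultimately have "fst (transfer e h (c * 1, c * 1) n) \<le> fst (transfer e h (p, q) n) \<and>
      snd (transfer e h (c * 1, c * 1) n) \<le> snd (transfer e h (p, q) n)"
    using transfer_mono[of e "transfer e h (c, c) 1" "transfer e h (p, q) 1"] e by (metis less_imp_le)
  then show ?thesis by (simp only: transfer_scale fst_conv snd_conv)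
qed

text \<open>The second block starts from the vector (p, q) left by the first one instead of from (1,
  1). By positivity the final mass is p + q times that of a fresh start, up to a factor between e /
  (1 + e) and 1.\<close>

lemma log_total_almost_additive:
  assumes e: "0 < e" "e \<le> 1"
  shows "\<bar>log_total e (m + n) h - log_total e m h - log_total e n (\<lambda>k. h (m + k))\<bar> \<le> ln ((1 + e) / e)"
proof -
  define p q where "p = fst (transfer e h (1, 1) m)" and "q = snd (transfer e h (1, 1) m)"
  define P Q where "P = fst (transfer e (\<lambda>k. h (m + k)) (1, 1) n)"
    and "Q = snd (transfer e (\<lambda>k. h (m + k)) (1, 1) n)"
  define P' Q' where "P' = fst (transfer e (\<lambda>k. h (m + k)) (p, q) n)"
    and "Q' = snd (transfer e (\<lambda>k. h (m + k)) (p, q) n)"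
  have pos: "p > 0" "q > 0" "P > 0" "Q > 0" "P' > 0" "Q' > 0"
    unfolding p_def q_def P_def Q_def P'_def Q'_def
    using e by (auto intro!: transfer_pos[THEN conjunct1] transfer_pos[THEN conjunct2])
  have add: "log_total e (m + n) h = ln (P' + Q')"
    unfolding log_total_def transfer_add P'_def Q'_def p_def q_def by simp
  have up: "P' + Q' \<le> (p + q) * (P + Q)"
    using transfer_le_total[of e p q "\<lambda>k. h (m + k)" n] pos e
    by (simp add: P_def Q_def P'_def Q'_def algebra_simps)
  have lo: "e / (1 + e) * ((p + q) * (P + Q)) \<le> P' + Q'"
  \<comment> \<open>The lower comparison requires at least one matrix. For an empty second block P =
    Q = 1 and the claim reduces to 2 e <= 1 + e.\<close>
  proof (cases "n = 0")
    case True
    have "e / (1 + e) * 2 \<le> 1" using e by (simp add: field_simps)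
    from mult_right_mono[OF this, of "p + q"] pos show ?thesis
      using True by (simp add: P_def Q_def P'_def Q'_def mult_ac)
  next
    case False
    with pos have "e / (1 + e) * (p + q) * P \<le> P'" "e / (1 + e) * (p + q) * Q \<le> Q'"
      using transfer_ge_total[OF e, of p q n "\<lambda>k. h (m + k)", folded P_def Q_def P'_def Q'_def] by auto
    then show ?thesis
      unfolding mult.assoc by (simp only: distrib_left[of _ P Q] distrib_left[of _ "_ * P"])
  qed
  have "ln (P' + Q') \<le> ln (p + q) + ln (P + Q)"
    using ln_mono[OF up] pos by (simp add: ln_mult)
  moreover have "ln (e / (1 + e)) + (ln (p + q) + ln (P + Q)) \<le> ln (P' + Q')"
  proof -
    have "ln (e / (1 + e)) + (ln (p + q) + ln (P + Q)) = ln (e / (1 + e) * ((p + q) * (P + Q)))"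
      using pos e by (simp add: ln_mult del: times_divide_eq_left)
    also have "\<dots> \<le> ln (P' + Q')" using lo pos e by (intro ln_mono) auto
    finally show ?thesis .
  qed
  moreover have "ln (e / (1 + e)) = - ln ((1 + e) / e)" using e by (simp add: ln_div)
  moreover have "0 \<le> ln ((1 + e) / e)" using e by (intro ln_ge_zero) (simp add: field_simps)
  moreover have "log_total e m h = ln (p + q)" "log_total e n (\<lambda>k. h (m + k)) = ln (P + Q)"
    by (simp_all add: log_total_def p_def q_def P_def Q_def)
  ultimately show ?thesis using add by linarith
qed

lemma log_total_1_bound:
  assumes e: "0 < e" "e \<le> 1"
  shows "\<bar>log_total e 1 h\<bar> \<le> \<bar>h 1\<bar> + 2"
proof -
  have E: "exp (h 1) \<le> exp \<bar>h 1\<bar>" "exp (- h 1) \<le> exp \<bar>h 1\<bar>" by auto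
  have "exp \<bar>h 1\<bar> \<le> exp (h 1) + exp (- h 1)" by (cases "h 1 \<ge> 0") auto
  moreover have "1 \<le> exp \<bar>h 1\<bar>" by simp
  ultimately have lo: "1 \<le> (1 + e) * (exp (h 1) + exp (- h 1))"
    using e mult_mono[of 1 "1 + e" 1 "exp (h 1) + exp (- h 1)"] by linarith
  have "(1 + e) * (exp (h 1) + exp (- h 1)) \<le> 2 * (2 * exp \<bar>h 1\<bar>)"
    using e E by (intro mult_mono add_nonneg_nonneg exp_ge_zero) linarith+
  also have "\<dots> \<le> exp 2 * exp \<bar>h 1\<bar>"
  proof -
    have "(2::real) \<le> exp 1" using exp_ge_add_one_self[of 1] by simp
    then have "2 * 2 \<le> exp 1 * exp (1::real)" by (intro mult_mono) auto
    then have "4 \<le> exp (2::real)" by (simp flip: exp_add)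
    from mult_right_mono[OF this, of "exp \<bar>h 1\<bar>"] show ?thesis by simp
  qed
  finally have up: "(1 + e) * (exp (h 1) + exp (- h 1)) \<le> exp (2 + \<bar>h 1\<bar>)" by (simp add: exp_add)
  have eq: "log_total e 1 h = ln ((1 + e) * (exp (h 1) + exp (- h 1)))"
    by (simp add: log_total_def algebra_simps)
  have "ln ((1 + e) * (exp (h 1) + exp (- h 1))) \<le> ln (exp (2 + \<bar>h 1\<bar>))"
    using up lo by (intro ln_mono) linarith+
  moreover have "0 \<le> ln ((1 + e) * (exp (h 1) + exp (- h 1)))"
    using lo by (rule ln_ge_zero)
  ultimately show ?thesis unfolding eq by simp
qed

lemma log_total_step:
  assumes "0 < e" "e \<le> 1"
  shows "\<bar>log_total e (Suc n) h - log_total e n h\<bar> \<le> ln ((1 + e) / e) + 2 + \<bar>h (Suc n)\<bar>"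
  using log_total_almost_additive[OF assms, of n 1 h] log_total_1_bound[OF assms, of "\<lambda>k. h (n + k)"]
  by (simp del: transfer.simps)

text \<open>Domination by a sum of site terms lets the integrability of fourth powers pass from the
  single-site law to \<open>log_total\<close>. The leading 1 covers the value ln 2 at n = 0.\<close>

lemma log_total_bound:
  assumes "0 < e" "e \<le> 1"
  shows "\<bar>log_total e n h\<bar> \<le> 1 + (\<Sum>k=1..n. ln ((1 + e) / e) + 2 + \<bar>h k\<bar>)"
proof (induction n)
  case 0
  have "ln 2 \<le> (1::real)" using ln_le_minus_one[of "2::real"] by simp
  then show ?case by (simp add: log_total_def)
next
  case (Suc n)
  then show ?case using log_total_step[OF assms, of n h] by simp
qed

text \<open>Serves two comparisons: unit vectors (p + q = 1) for fixed boundary spins, and (1, 1) (p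
  + q = 2) for the geometric mean. The last matrix mixes the entries, so each of them is at least a
  fraction of order e of the total mass, up to the distortion exp (2 |h n|) by the last
  field.\<close>

lemma ln_transfer_component:
  assumes e: "0 < e" "e \<le> 1" and v: "0 \<le> p" "0 \<le> q" "p + q \<ge> 1" "p + q \<le> 2" and n: "0 < n"
  defines "K \<equiv> ln ((1 + e) / e) + ln (2 / e) + 1"
  shows "\<bar>ln (fst (transfer e h (p, q) n)) - log_total e n h\<bar> \<le> K + 2 * \<bar>h n\<bar>"
    and "\<bar>ln (snd (transfer e h (p, q) n)) - log_total e n h\<bar> \<le> K + 2 * \<bar>h n\<bar>"
proof -
  obtain m where m: "n = Suc m" using n by (metis not0_implies_Suc not_gr0)
  define r s where "r = fst (transfer e h (1, 1) m)" and "s = snd (transfer e h (1, 1) m)"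
  have rs: "r > 0" "s > 0"
    unfolding r_def s_def using transfer_pos[of e "(1,1)" h m] e by auto
  define P Q where "P = fst (transfer e h (1, 1) n)" and "Q = snd (transfer e h (1, 1) n)"
  have PQ: "P > 0" "Q > 0"
    unfolding P_def Q_def using transfer_pos[of e "(1,1)" h n] e by auto
  have P: "P = exp (h n) * (r + e * s)" and Q: "Q = exp (- h n) * (e * r + s)"
    by (simp_all add: P_def Q_def m r_def s_def)
  have es: "e * r \<le> r" "e * s \<le> s" using mult_right_mono[OF e(2)] rs by auto
  have ehn: "exp (h n) \<le> exp \<bar>h n\<bar>" "exp (- h n) \<le> exp \<bar>h n\<bar>"
    "exp (- \<bar>h n\<bar>) \<le> exp (h n)" "exp (- \<bar>h n\<bar>) \<le> exp (- h n)" by auto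
  have "P \<le> exp \<bar>h n\<bar> * (r + s)" "Q \<le> exp \<bar>h n\<bar> * (r + s)"
    unfolding P Q using ehn es rs e by (auto intro!: mult_mono)
  then have tot: "P + Q \<le> 2 * exp \<bar>h n\<bar> * (r + s)" by linarith
  have Pl: "exp (- \<bar>h n\<bar>) * (e * (r + s)) \<le> P" "exp (- \<bar>h n\<bar>) * (e * (r + s)) \<le> Q"
    unfolding P Q using ehn es rs e by (intro mult_mono; auto simp: distrib_left)+
  \<comment> \<open>Here y stands for an entry started from (1, 1) and x for the same entry started
    from (p, q).\<close>
  have lnbd: "\<bar>ln x - log_total e n h\<bar> \<le> K + 2 * \<bar>h n\<bar>"
    if x: "e / (1 + e) * y \<le> x" "x \<le> 2 * y" and y: "exp (- \<bar>h n\<bar>) * (e * (r + s)) \<le> y" "y \<le> P + Q"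
    for x y
  proof -
    have y0: "y > 0" by (rule less_le_trans[OF _ y(1)]) (use e rs in auto)
    then have c: "0 < e / (1 + e) * y" using e by simp
    have x0: "x > 0" using x(1) c by linarith
    have L: "log_total e n h = ln (P + Q)" by (simp add: log_total_def P_def Q_def)
    have "ln x \<le> ln (2 * (P + Q))" using x y x0 by (intro ln_mono) auto
    also have "\<dots> = ln 2 + ln (P + Q)" using PQ by (subst ln_mult) auto
    finally have up: "ln x \<le> ln 2 + ln (P + Q)" .
    have "ln (e / (1 + e) * y) \<le> ln x" using x c x0 by (intro ln_mono) auto
    then have l1: "ln y - ln ((1 + e) / e) \<le> ln x" using e y0 by (simp add: ln_mult ln_div)
    have "ln (exp (- \<bar>h n\<bar>) * (e * (r + s))) \<le> ln y"
      using y e rs y0 by (intro ln_mono) auto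
    then have l2: "- \<bar>h n\<bar> + ln e + ln (r + s) \<le> ln y" using e rs by (simp add: ln_mult)
    have "ln (P + Q) \<le> ln (2 * exp \<bar>h n\<bar> * (r + s))" using tot PQ rs by (intro ln_mono) auto
    then have l3: "ln (P + Q) \<le> ln 2 + \<bar>h n\<bar> + ln (r + s)" using rs by (simp add: ln_mult)
    have "ln 2 \<le> (1::real)" using ln_le_minus_one[of "2::real"] by simp
    moreover have "0 \<le> ln ((1 + e) / e)" using e by (intro ln_ge_zero) (simp add: field_simps)
    moreover have "0 \<le> ln (2 / e)" using e by (intro ln_ge_zero) (simp add: field_simps)
    moreover have "ln (2 / e) = ln 2 - ln e" using e by (simp add: ln_div)
    ultimately show ?thesis unfolding L K_def using up l1 l2 l3 by linarith
  qed
  have lo: "e / (1 + e) * P \<le> e / (1 + e) * (p + q) * P" "e / (1 + e) * Q \<le> e / (1 + e) * (p + q) * Q"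
    using mult_right_mono[OF v(3), of "e / (1 + e) * P"] mult_right_mono[OF v(3), of "e / (1 + e) * Q"] PQ e
    by (simp_all add: mult_ac)
  have hi: "(p + q) * P \<le> 2 * P" "(p + q) * Q \<le> 2 * Q" using v PQ by auto
  note ge = transfer_ge_total[OF e v(1,2) n, of h, folded P_def Q_def]
  note le = transfer_le_total[OF less_imp_le[OF e(1)] v(1,2), of h n, folded P_def Q_def]
  show "\<bar>ln (fst (transfer e h (p, q) n)) - log_total e n h\<bar> \<le> K + 2 * \<bar>h n\<bar>"
    by (rule lnbd[of P]) (use ge le lo hi Pl PQ in linarith)+
  show "\<bar>ln (snd (transfer e h (p, q) n)) - log_total e n h\<bar> \<le> K + 2 * \<bar>h n\<bar>"
    by (rule lnbd[of Q]) (use ge le lo hi Pl PQ in linarith)+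
qed

section \<open>Laws of large numbers\<close>

lemma (in finite_measure) integrable_power_le_4:
  fixes f :: "'a \<Rightarrow> real"
  assumes [measurable]: "f \<in> borel_measurable M" and int: "integrable M (\<lambda>x. f x ^ 4)" and k: "k \<le> 4"
  shows "integrable M (\<lambda>x. f x ^ k)"
proof (rule Bochner_Integration.integrable_bound[of _ "\<lambda>x. 1 + f x ^ 4"])
  have "\<bar>y\<bar> ^ k \<le> 1 + \<bar>y\<bar> ^ 4" for y :: real
  proof (cases "\<bar>y\<bar> \<le> 1")
    case True
    then have "\<bar>y\<bar> ^ k \<le> 1" by (simp add: power_le_one)
    then show ?thesis by (simp add: add_increasing2)
  next
    case False
    then have "\<bar>y\<bar> ^ k \<le> \<bar>y\<bar> ^ 4" using k by (intro power_increasing) auto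
    then show ?thesis by linarith
  qed
  then show "AE x in M. norm (f x ^ k) \<le> norm (1 + f x ^ 4)"
    by (auto simp: power_abs)
qed (use int in auto)

text \<open>Second and fourth moments go through one induction because the fourth power of S + X
  leaves the cross term 6 E(X^2) E(S^2). Terms with a first power of X or of S vanish by
  independence and centring. Of the increment 6 n + 3 of 3 n^2 only 6 n + 1 is consumed.\<close>

lemma (in prob_space) fourth_moment_sum:
  fixes X :: "nat \<Rightarrow> 'a \<Rightarrow> real"
  assumes ind: "indep_vars (\<lambda>_. borel) X UNIV"
    and int: "\<And>i. integrable M (\<lambda>\<omega>. X i \<omega> ^ 4)"
    and mean: "\<And>i. expectation (X i) = 0"
    and bound: "\<And>i. expectation (\<lambda>\<omega>. X i \<omega> ^ 4) \<le> K"
  shows "integrable M (\<lambda>\<omega>. (\<Sum>i<n. X i \<omega>) ^ 4) \<and>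
    expectation (\<lambda>\<omega>. \<Sum>i<n. X i \<omega>) = 0 \<and>
    expectation (\<lambda>\<omega>. (\<Sum>i<n. X i \<omega>) ^ 2) \<le> real n * (1 + K) \<and>
    expectation (\<lambda>\<omega>. (\<Sum>i<n. X i \<omega>) ^ 4) \<le> 3 * (real n)\<^sup>2 * (1 + K)\<^sup>2"
proof (induction n)
  case 0
  show ?case by simp
next
  case (Suc n)
  define S where "S = (\<lambda>\<omega>. \<Sum>i<n. X i \<omega>)"
  have X[measurable]: "X i \<in> borel_measurable M" for i
    using ind by (auto simp: indep_vars_def)
  have [measurable]: "S \<in> borel_measurable M" unfolding S_def by measurable
  have S4: "integrable M (\<lambda>\<omega>. S \<omega> ^ 4)" and S1: "expectation S = 0"
    and S2: "expectation (\<lambda>\<omega>. S \<omega> ^ 2) \<le> real n * (1 + K)"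
    and SE: "expectation (\<lambda>\<omega>. S \<omega> ^ 4) \<le> 3 * (real n)\<^sup>2 * (1 + K)\<^sup>2"
    using Suc unfolding S_def by auto
  have K: "0 \<le> K" 
    by (rule order_trans[OF _ bound[of 0]]) (simp add: integral_nonneg_AE)
  have Xk: "integrable M (\<lambda>\<omega>. X n \<omega> ^ k)" if "k \<le> 4" for k
    using integrable_power_le_4[OF X int that] .
  have Sk: "integrable M (\<lambda>\<omega>. S \<omega> ^ k)" if "k \<le> 4" for k
    using integrable_power_le_4[OF _ S4 that] by simp
  have ind': "indep_var borel (X n) borel S"
    unfolding S_def by (rule indep_vars_sum) (auto intro: indep_vars_subset[OF ind])
  have indk: "indep_var borel (\<lambda>\<omega>. X n \<omega> ^ j) borel (\<lambda>\<omega>. S \<omega> ^ k)" for j k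
    using indep_var_compose[OF ind', of "\<lambda>x. x ^ j" borel "\<lambda>x. x ^ k" borel] by (simp add: comp_def)
  have I[simp]: "integrable M (\<lambda>\<omega>. X n \<omega> ^ j * S \<omega> ^ k)"
    and E: "expectation (\<lambda>\<omega>. X n \<omega> ^ j * S \<omega> ^ k) =
      expectation (\<lambda>\<omega>. X n \<omega> ^ j) * expectation (\<lambda>\<omega>. S \<omega> ^ k)"
    if "j \<le> 4" "k \<le> 4" for j k
    using indep_var_integrable[OF indk Xk Sk] indep_var_lebesgue_integral[OF indk Xk Sk] that by auto
  have X2: "expectation (\<lambda>\<omega>. X n \<omega> ^ 2) \<le> 1 + K"
  proof -
    have "expectation (\<lambda>\<omega>. X n \<omega> ^ 2) \<le> expectation (\<lambda>\<omega>. 1 + X n \<omega> ^ 4)"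
    proof (rule integral_mono)
      fix \<omega>
      have "0 \<le> (X n \<omega> ^ 2 - 1 / 2) ^ 2" by simp
      then show "X n \<omega> ^ 2 \<le> 1 + X n \<omega> ^ 4"
        by (simp add: power2_eq_square algebra_simps power4_eq_xxxx)
    qed (use int Xk in auto)
    also have "\<dots> \<le> 1 + K" using bound[of n] int by (simp add: prob_space)
    finally show ?thesis .
  qed
  have e4: "(\<Sum>i<Suc n. X i \<omega>) ^ 4 = S \<omega> ^ 4 + 4 * (X n \<omega> ^ 1 * S \<omega> ^ 3) + 6 * (X n \<omega> ^ 2 * S \<omega> ^ 2)
      + 4 * (X n \<omega> ^ 3 * S \<omega> ^ 1) + X n \<omega> ^ 4" for \<omega>
  proof -
    have "(s + x) ^ 4 = s ^ 4 + 4 * (x ^ 1 * s ^ 3) + 6 * (x ^ 2 * s ^ 2) + 4 * (x ^ 3 * s ^ 1) + x ^ 4"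
      for s x :: real
      by (simp add: eval_nat_numeral algebra_simps)
    from this[of "S \<omega>" "X n \<omega>"] show ?thesis by (simp only: S_def sum.lessThan_Suc)
  qed
  have e2: "(\<Sum>i<Suc n. X i \<omega>) ^ 2 = S \<omega> ^ 2 + 2 * (X n \<omega> ^ 1 * S \<omega> ^ 1) + X n \<omega> ^ 2" for \<omega>
  proof -
    have "(s + x) ^ 2 = s ^ 2 + 2 * (x ^ 1 * s ^ 1) + x ^ 2" for s x :: real
      by (simp add: power2_eq_square algebra_simps)
    from this[of "S \<omega>" "X n \<omega>"] show ?thesis by (simp only: S_def sum.lessThan_Suc)
  qed
  have e1: "(\<Sum>i<Suc n. X i \<omega>) = S \<omega> + X n \<omega>" for \<omega>
    by (simp add: S_def)
  have mean': "expectation (\<lambda>\<omega>. X n \<omega> ^ 1) = 0" "expectation (\<lambda>\<omega>. S \<omega> ^ 1) = 0"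
    using mean[of n] S1 by simp_all
  have lin2: "expectation (\<lambda>\<omega>. f1 \<omega> + 2 * f2 \<omega> + f3 \<omega>) = expectation f1 + 2 * expectation f2 + expectation f3"
    if "integrable M f1" "integrable M f2" "integrable M f3" for f1 f2 f3 :: "'a \<Rightarrow> real"
    using that by simp
  have lin4: "expectation (\<lambda>\<omega>. f1 \<omega> + 4 * f2 \<omega> + 6 * f3 \<omega> + 4 * f4 \<omega> + f5 \<omega>) =
      expectation f1 + 4 * expectation f2 + 6 * expectation f3 + 4 * expectation f4 + expectation f5"
    if "integrable M f1" "integrable M f2" "integrable M f3" "integrable M f4" "integrable M f5"
    for f1 f2 f3 f4 f5 :: "'a \<Rightarrow> real"
    using that by simp
  have "integrable M (\<lambda>\<omega>. (\<Sum>i<Suc n. X i \<omega>) ^ 4)"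
    unfolding e4 using S4 int by (intro Bochner_Integration.integrable_add integrable_mult_right I) auto
  moreover have "expectation (\<lambda>\<omega>. \<Sum>i<Suc n. X i \<omega>) = 0"
    unfolding e1 using Sk[of 1] Xk[of 1] mean[of n] S1 by simp
  moreover have "expectation (\<lambda>\<omega>. (\<Sum>i<Suc n. X i \<omega>) ^ 2) \<le> real (Suc n) * (1 + K)"
  proof -
    have "expectation (\<lambda>\<omega>. (\<Sum>i<Suc n. X i \<omega>) ^ 2) =
        expectation (\<lambda>\<omega>. S \<omega> ^ 2) + 2 * expectation (\<lambda>\<omega>. X n \<omega> ^ 1 * S \<omega> ^ 1) + expectation (\<lambda>\<omega>. X n \<omega> ^ 2)"
      unfolding e2 by (rule lin2) (use Sk[of 2] Xk[of 2] I[of 1 1] in auto)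
    then show ?thesis using E[of 1 1] mean' S2 X2 by (simp add: algebra_simps)
  qed
  moreover have "expectation (\<lambda>\<omega>. (\<Sum>i<Suc n. X i \<omega>) ^ 4) \<le> 3 * (real (Suc n))\<^sup>2 * (1 + K)\<^sup>2"
  proof -
    have "expectation (\<lambda>\<omega>. (\<Sum>i<Suc n. X i \<omega>) ^ 4) =
        expectation (\<lambda>\<omega>. S \<omega> ^ 4) + 4 * expectation (\<lambda>\<omega>. X n \<omega> ^ 1 * S \<omega> ^ 3)
        + 6 * expectation (\<lambda>\<omega>. X n \<omega> ^ 2 * S \<omega> ^ 2) + 4 * expectation (\<lambda>\<omega>. X n \<omega> ^ 3 * S \<omega> ^ 1)
        + expectation (\<lambda>\<omega>. X n \<omega> ^ 4)"
      unfolding e4 by (intro lin4 S4 int I) simp_all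
    also have "\<dots> = expectation (\<lambda>\<omega>. S \<omega> ^ 4)
        + 6 * (expectation (\<lambda>\<omega>. X n \<omega> ^ 2) * expectation (\<lambda>\<omega>. S \<omega> ^ 2)) + expectation (\<lambda>\<omega>. X n \<omega> ^ 4)"
      using E[of 1 3] E[of 2 2] E[of 3 1] mean' by simp
    also have "\<dots> \<le> 3 * (real n)\<^sup>2 * (1 + K)\<^sup>2 + 6 * ((1 + K) * (real n * (1 + K))) + (1 + K)\<^sup>2"
    proof (intro add_mono mult_left_mono mult_mono)
      have "K \<le> (1 + K)\<^sup>2" using K by (simp add: power2_eq_square algebra_simps)
      then show "expectation (\<lambda>\<omega>. X n \<omega> ^ 4) \<le> (1 + K)\<^sup>2" using bound[of n] by linarith
    qed (use SE S2 X2 K in auto)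
    also have "\<dots> \<le> 3 * (real (Suc n))\<^sup>2 * (1 + K)\<^sup>2"
    proof -
      have "3 * (real n)\<^sup>2 * (1 + K)\<^sup>2 + 6 * ((1 + K) * (real n * (1 + K))) + (1 + K)\<^sup>2 + 2 * (1 + K)\<^sup>2
          = 3 * (real (Suc n))\<^sup>2 * (1 + K)\<^sup>2"
        by (simp add: power2_eq_square algebra_simps)
      moreover have "0 \<le> 2 * (1 + K)\<^sup>2" by simp
      ultimately show ?thesis by linarith
    qed
    finally show ?thesis .
  qed
  ultimately show ?case by blast
qed

text \<open>The fourth moment of the n-th average is of order 1 / n^2, hence summable; the series of
  fourth powers is therefore almost surely finite and its terms tend to 0.\<close>

theorem (in prob_space) strong_law_fourth_moment:
  fixes X :: "nat \<Rightarrow> 'a \<Rightarrow> real"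
  assumes ind: "indep_vars (\<lambda>_. borel) X UNIV"
    and int: "\<And>i. integrable M (\<lambda>\<omega>. X i \<omega> ^ 4)"
    and mean: "\<And>i. expectation (X i) = 0"
    and bound: "\<And>i. expectation (\<lambda>\<omega>. X i \<omega> ^ 4) \<le> K"
  shows "AE \<omega> in M. (\<lambda>n. (\<Sum>i<n. X i \<omega>) / real n) \<longlonglongrightarrow> 0"
proof -
  have [measurable]: "X i \<in> borel_measurable M" for i
    using ind by (auto simp: indep_vars_def)
  define f where "f = (\<lambda>n \<omega>. ((\<Sum>i<n. X i \<omega>) / real n) ^ 4)"
  have f0: "0 \<le> f n \<omega>" for n \<omega> by (simp add: f_def)
  have [measurable]: "f n \<in> borel_measurable M" for n unfolding f_def by measurable
  note moment = fourth_moment_sum[OF assms]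
  have fint: "integrable M (f n)" for n
    unfolding f_def power_divide using moment[of n] by simp
  have fE: "expectation (f n) \<le> 3 * (1 + K)\<^sup>2 * inverse (real n ^ 2)" for n
  proof (cases "n = 0")
    case False
    have "expectation (f n) = expectation (\<lambda>\<omega>. (\<Sum>i<n. X i \<omega>) ^ 4) / real n ^ 4"
      unfolding f_def power_divide by simp
    also have "\<dots> \<le> 3 * (real n)\<^sup>2 * (1 + K)\<^sup>2 / real n ^ 4"
      using moment[of n] by (intro divide_right_mono) auto
    also have "\<dots> = 3 * (1 + K)\<^sup>2 * inverse (real n ^ 2)"
      using False by (simp add: field_simps power2_eq_square power4_eq_xxxx)
    finally show ?thesis .
  qed (simp add: f_def)
  have sumE: "summable (\<lambda>n. expectation (f n))"
  proof (rule summable_comparison_test')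
    show "summable (\<lambda>n. 3 * (1 + K)\<^sup>2 * inverse (real n ^ 2))"
      by (intro summable_mult inverse_power_summable) simp
    show "norm (expectation (f n)) \<le> 3 * (1 + K)\<^sup>2 * inverse (real n ^ 2)" if "0 \<le> n" for n
      using fE[of n] f0 by (simp add: integral_nonneg_AE)
  qed
  have "(\<integral>\<^sup>+\<omega>. (\<Sum>n. ennreal (f n \<omega>)) \<partial>M) = (\<Sum>n. \<integral>\<^sup>+\<omega>. ennreal (f n \<omega>) \<partial>M)"
    by (intro nn_integral_suminf) measurable
  also have "\<dots> = (\<Sum>n. ennreal (expectation (f n)))"
    by (intro suminf_cong nn_integral_eq_integral fint) (simp add: f0)
  finally have eq: "(\<integral>\<^sup>+\<omega>. (\<Sum>n. ennreal (f n \<omega>)) \<partial>M) = (\<Sum>n. ennreal (expectation (f n)))" .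
  have "(\<Sum>n. ennreal (expectation (f n))) \<noteq> \<infinity>"
    unfolding infinity_ennreal_def by (rule ennreal_suminf_neq_top[OF sumE]) (simp add: f0 integral_nonneg_AE)
  then have "AE \<omega> in M. (\<Sum>n. ennreal (f n \<omega>)) \<noteq> \<infinity>"
    unfolding eq[symmetric] by (rule nn_integral_PInf_AE[rotated]) measurable
  then show ?thesis
  proof eventually_elim
    fix \<omega> assume "(\<Sum>n. ennreal (f n \<omega>)) \<noteq> \<infinity>"
    then have "summable (\<lambda>n. f n \<omega>)"
      by (intro summable_suminf_not_top) (auto simp: f0)
    then have "(\<lambda>n. f n \<omega>) \<longlonglongrightarrow> 0" by (rule summable_LIMSEQ_zero)
    then have "(\<lambda>n. sqrt (sqrt (f n \<omega>))) \<longlonglongrightarrow> sqrt (sqrt 0)"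
      by (intro tendsto_real_sqrt)
    moreover have "sqrt (sqrt (y ^ 4)) = \<bar>y\<bar>" for y :: real
    proof -
      have "y ^ 4 = (y\<^sup>2)\<^sup>2" by simp
      then show ?thesis by (simp only: real_sqrt_abs) simp
    qed
    ultimately show "(\<lambda>n. (\<Sum>i<n. X i \<omega>) / real n) \<longlonglongrightarrow> 0"
      unfolding f_def by (simp add: tendsto_rabs_zero_iff del: abs_divide)
  qed
qed

section \<open>From block averages to the whole trajectory\<close>

lemma real_div_over_self_tendsto:
  fixes m :: nat
  assumes "0 < m"
  shows "(\<lambda>n. real (n div m) / real n) \<longlonglongrightarrow> 1 / real m"
proof -
  have "(\<lambda>n. real (n mod m) / real n) \<longlonglongrightarrow> 0"
  proof (rule tendsto_sandwich[of "\<lambda>_. 0" _ _ "\<lambda>n. real m / real n"])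
    show "\<forall>\<^sub>F n in sequentially. real (n mod m) / real n \<le> real m / real n"
      using assms by (intro always_eventually allI divide_right_mono) (auto intro: less_imp_le)
  qed (auto intro: lim_const_over_n)
  then have "(\<lambda>n. (1 - real (n mod m) / real n) / real m) \<longlonglongrightarrow> (1 - 0) / real m"
    using assms by (intro tendsto_intros) auto
  moreover have "\<forall>\<^sub>F n in sequentially. (1 - real (n mod m) / real n) / real m = real (n div m) / real n"
    using eventually_gt_at_top[of 0]
  proof eventually_elim
    fix n :: nat assume "0 < n"
    have "real n = real m * real (n div m) + real (n mod m)"
      by (metis mult_div_mod_eq of_nat_add of_nat_mult)
    then have "real n - real (n mod m) = real m * real (n div m)" by simp
    moreover have "1 - real (n mod m) / real n = (real n - real (n mod m)) / real n"
      using \<open>0 < n\<close> by (simp add: field_simps)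
    ultimately show "(1 - real (n mod m) / real n) / real m = real (n div m) / real n"
      using assms by simp
  qed
  ultimately show ?thesis by (simp add: tendsto_cong)
qed

text \<open>The discrepancy between a trajectory and its decomposition into blocks of length \<open>m\<close> is
  \<open>O(1/m)\<close> per unit length, so blocks whose averages converge force the trajectory to converge.\<close>

lemma block_averages_tendsto:
  fixes X h g :: "nat \<Rightarrow> real" and Y :: "nat \<Rightarrow> nat \<Rightarrow> real"
  assumes blocks: "\<And>m k. 0 < m \<Longrightarrow> \<bar>X (m * k) - (\<Sum>i<k. Y m i)\<bar> \<le> C * real k + 1"
    and step: "\<And>n. \<bar>X (Suc n) - X n\<bar> \<le> D + \<bar>h (Suc n)\<bar>"
    and h: "(\<lambda>n. h n / real n) \<longlonglongrightarrow> 0"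
    and Y: "\<And>m. 0 < m \<Longrightarrow> (\<lambda>k. (\<Sum>i<k. Y m i) / real k) \<longlonglongrightarrow> g m"
    and C: "0 \<le> C" and D: "0 \<le> D"
  shows "\<exists>F. (\<lambda>n. X n / real n) \<longlonglongrightarrow> F \<and> (\<lambda>m. g m / real m) \<longlonglongrightarrow> F"
proof -
  have steps: "\<bar>X n - X (n - r)\<bar> \<le> (\<Sum>j<r. D + \<bar>h (n - j)\<bar>)" if "r \<le> n" for n r
    using that
  proof (induction r)
    case (Suc r)
    have "n - r = Suc (n - Suc r)" using Suc.prems by simp
    then show ?case using Suc.IH Suc.prems step[of "n - Suc r"] by (simp only: sum.lessThan_Suc) linarith
  qed simp
  \<comment> \<open>Of the bound (C + 1) / m, the part C / m pays for the block junctions, at most n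
    / m of them at cost C each; the part 1 / m absorbs everything that vanishes as n grows.\<close>
  have ev: "\<forall>\<^sub>F n in sequentially. \<bar>X n / real n - g m / real m\<bar> \<le> (C + 1) / real m" if m: "0 < m" for m
  proof -
    \<comment> \<open>Cost per site of the incomplete last block. It has fewer than m sites, so for
      fixed m it vanishes by the sublinearity of h.\<close>
    define u where "u = (\<lambda>n. (\<Sum>j<m. D + \<bar>h (n - j)\<bar>) / real n)"
    have hj: "(\<lambda>n. \<bar>h (n - j)\<bar> / real n) \<longlonglongrightarrow> 0" for j
    proof (rule LIMSEQ_offset[where k = j])
      show "(\<lambda>n. \<bar>h (n + j - j)\<bar> / real (n + j)) \<longlonglongrightarrow> 0"
      proof (rule tendsto_sandwich[of "\<lambda>_. 0" _ _ "\<lambda>n. \<bar>h n / real n\<bar>"])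
        show "\<forall>\<^sub>F n in sequentially. \<bar>h (n + j - j)\<bar> / real (n + j) \<le> \<bar>h n / real n\<bar>"
          using eventually_gt_at_top[of 0]
          by eventually_elim (auto intro!: divide_left_mono)
      qed (use tendsto_rabs_zero[OF h] in auto)
    qed
    have "(\<lambda>n. \<Sum>j<m. D / real n + \<bar>h (n - j)\<bar> / real n) \<longlonglongrightarrow> (\<Sum>j<m. 0 + 0)"
      by (intro tendsto_sum tendsto_add hj lim_const_over_n)
    then have u: "u \<longlonglongrightarrow> 0"
      by (simp add: u_def sum_divide_distrib add_divide_distrib del: sum.distrib)
    have t3: "(\<lambda>n. (\<Sum>i<n div m. Y m i) / real n) \<longlonglongrightarrow> g m / real m"
    proof -
      have "filterlim (\<lambda>n. n div m) at_top sequentially"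
        using m by (rule filterlim_at_top_div_const_nat)
      from filterlim_compose[OF Y[OF m] this]
      have "(\<lambda>n. (\<Sum>i<n div m. Y m i) / real (n div m) * (real (n div m) / real n)) \<longlonglongrightarrow> g m * (1 / real m)"
        by (intro tendsto_mult real_div_over_self_tendsto m)
      \<comment> \<open>The cancellation persists for \<open>n div m = 0\<close>, where the sum is
        empty and both sides are 0.\<close>
      moreover have "(\<Sum>i<n div m. Y m i) / real (n div m) * (real (n div m) / real n) = (\<Sum>i<n div m. Y m i) / real n" for n
        by (cases "n div m = 0") (simp_all del: div_eq_0_iff)
      ultimately show ?thesis by (simp only: mult_1_right times_divide_eq_right)
    qed
    have "(\<lambda>n. u n + 1 / real n + \<bar>(\<Sum>i<n div m. Y m i) / real n - g m / real m\<bar>) \<longlonglongrightarrow> 0 + 0 + \<bar>g m / real m - g m / real m\<bar>"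
      by (intro tendsto_intros u t3 lim_const_over_n)
    then have "(\<lambda>n. u n + 1 / real n + \<bar>(\<Sum>i<n div m. Y m i) / real n - g m / real m\<bar>) \<longlonglongrightarrow> 0" by simp
    from order_tendstoD(2)[OF this, of "1 / real m"] m
    have "\<forall>\<^sub>F n in sequentially. u n + 1 / real n + \<bar>(\<Sum>i<n div m. Y m i) / real n - g m / real m\<bar> < 1 / real m"
      by simp
    then show ?thesis
      using eventually_gt_at_top[of 0]
    proof eventually_elim
      fix n :: nat
      assume small: "u n + 1 / real n + \<bar>(\<Sum>i<n div m. Y m i) / real n - g m / real m\<bar> < 1 / real m"
        and n: "0 < n"
      have "\<bar>X n - X (m * (n div m))\<bar> \<le> (\<Sum>j<n mod m. D + \<bar>h (n - j)\<bar>)"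
        using steps[of "n mod m" n] by (simp add: minus_mod_eq_mult_div)
      also have "\<dots> \<le> (\<Sum>j<m. D + \<bar>h (n - j)\<bar>)"
        using m D by (intro sum_mono2) (auto intro: less_trans[OF _ mod_less_divisor])
      finally have a: "\<bar>X n - X (m * (n div m))\<bar> / real n \<le> u n"
        unfolding u_def by (intro divide_right_mono) auto
      have "real (n div m) * real m \<le> real n"
        by (metis div_times_less_eq_dividend of_nat_le_iff of_nat_mult)
      then have km: "real (n div m) / real n \<le> 1 / real m"
        using m n by (simp add: field_simps)
      have "\<bar>X (m * (n div m)) - (\<Sum>i<n div m. Y m i)\<bar> / real n \<le> (C * real (n div m) + 1) / real n"
        by (intro divide_right_mono blocks m) auto
      also have "\<dots> = C * (real (n div m) / real n) + 1 / real n" by (simp add: add_divide_distrib)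
      also have "\<dots> \<le> C * (1 / real m) + 1 / real n" using km C by (intro add_mono mult_left_mono) auto
      finally have b: "\<bar>X (m * (n div m)) - (\<Sum>i<n div m. Y m i)\<bar> / real n \<le> C / real m + 1 / real n" by simp
      have "X n / real n - g m / real m = (X n - X (m * (n div m))) / real n
          + (X (m * (n div m)) - (\<Sum>i<n div m. Y m i)) / real n + ((\<Sum>i<n div m. Y m i) / real n - g m / real m)"
        by (simp add: diff_divide_distrib)
      also have "\<bar>\<dots>\<bar> \<le> \<bar>X n - X (m * (n div m))\<bar> / real n
          + \<bar>X (m * (n div m)) - (\<Sum>i<n div m. Y m i)\<bar> / real n + \<bar>(\<Sum>i<n div m. Y m i) / real n - g m / real m\<bar>"
        by (intro order_trans[OF abs_triangle_ineq] add_mono) (auto simp: abs_divide)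
      finally show "\<bar>X n / real n - g m / real m\<bar> \<le> (C + 1) / real m"
        using a b small by (simp add: add_divide_distrib)
    qed
  qed
  have Cm: "\<exists>m>0. (C + 1) / real m < e" if "0 < e" for e
  proof -
    obtain m :: nat where "(C + 1) / e < real m" using reals_Archimedean2 by blast
    moreover from this have "0 < real m" using C that by (smt (verit) divide_nonneg_pos)
    ultimately show ?thesis using that by (intro exI[of _ m]) (auto simp: field_simps)
  qed
  \<comment> \<open>For each m the values \<open>X n / real n\<close> eventually stay within (C + 1)
    / m of the single number \<open>g m / real m\<close>, which forces the Cauchy property. In the
    limit the same bound holds between F and \<open>g m / real m\<close>.\<close>
  have "Cauchy (\<lambda>n. X n / real n)"
  proof (rule metric_CauchyI)
    fix e :: real assume "0 < e"
    then obtain m where m: "0 < m" "(C + 1) / real m < e / 2" using Cm[of "e / 2"] by auto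
    from ev[OF m(1)] obtain N where N: "\<And>n. n \<ge> N \<Longrightarrow> \<bar>X n / real n - g m / real m\<bar> \<le> (C + 1) / real m"
      by (auto simp: eventually_at_top_linorder)
    show "\<exists>N. \<forall>p\<ge>N. \<forall>n\<ge>N. dist (X p / real p) (X n / real n) < e"
    proof (intro exI allI impI)
      fix p n assume "N \<le> p" "N \<le> n"
      then show "dist (X p / real p) (X n / real n) < e"
        using N[of p] N[of n] m(2) unfolding dist_real_def by linarith
    qed
  qed
  then obtain F where F: "(\<lambda>n. X n / real n) \<longlonglongrightarrow> F"
    by (auto simp: Cauchy_convergent_iff convergent_def)
  have "\<bar>F - g m / real m\<bar> \<le> (C + 1) / real m" if "0 < m" for m
    by (rule tendsto_upperbound[OF _ ev[OF that]]) (auto intro!: tendsto_intros F)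
  then have "\<forall>\<^sub>F m in sequentially. norm (g m / real m - F) \<le> (C + 1) / real m"
    by (intro eventually_mono[OF eventually_gt_at_top[of 0]]) (simp add: abs_minus_commute)
  then have "(\<lambda>m. g m / real m - F) \<longlonglongrightarrow> 0"
    by (rule Lim_null_comparison) (rule lim_const_over_n)
  with F show ?thesis by (auto simp: LIM_zero_iff)
qed

section \<open>Existence of the free energy\<close>

lemma transfer_cong:
  "(\<And>k. k \<in> {1..n} \<Longrightarrow> h k = h' k) \<Longrightarrow> transfer e h v n = transfer e h' v n"
  by (induction n) auto

lemma log_total_cong:
  "(\<And>k. k \<in> {1..n} \<Longrightarrow> h k = h' k) \<Longrightarrow> log_total e n h = log_total e n h'"
  unfolding log_total_def using transfer_cong[of n h h'] by metis

lemma borel_measurable_log_total: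
  assumes "\<And>k. k \<in> {1..n} \<Longrightarrow> (\<lambda>x. H x k) \<in> borel_measurable M"
  shows "(\<lambda>x. log_total e n (H x)) \<in> borel_measurable M"
proof -
  have [measurable]: "(\<lambda>x. fst (transfer e (H x) (1, 1) n)) \<in> borel_measurable M"
    "(\<lambda>x. snd (transfer e (H x) (1, 1) n)) \<in> borel_measurable M"
    using borel_measurable_transfer[of n H M e "(1, 1)"] assms by auto
  show ?thesis unfolding log_total_def by simp
qed

lemma log_total_blocks:
  assumes e: "0 < e" "e \<le> 1"
  shows "\<bar>log_total e (m * k) h - (\<Sum>i<k. log_total e m (\<lambda>n. h (m * i + n)))\<bar> \<le> ln ((1 + e) / e) * real k + 1"
proof (induction k)
  case 0
  show ?case using log_total_bound[OF e, of 0 h] by simp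
next
  case (Suc k)
  have "m * Suc k = m * k + m" by simp
  then show ?case
    using log_total_almost_additive[OF e, of "m * k" m h] Suc
    by (simp only: sum.lessThan_Suc of_nat_Suc distrib_left mult_1_right)
qed

lemma (in finite_measure) integrable_power4_add:
  fixes f g :: "'a \<Rightarrow> real"
  assumes [measurable]: "f \<in> borel_measurable M" "g \<in> borel_measurable M"
    and int: "integrable M (\<lambda>x. f x ^ 4)" "integrable M (\<lambda>x. g x ^ 4)"
  shows "integrable M (\<lambda>x. (f x + g x) ^ 4)"
proof (rule Bochner_Integration.integrable_bound[of _ "\<lambda>x. 8 * f x ^ 4 + 8 * g x ^ 4"])
  have sq: "(a + b)\<^sup>2 \<le> 2 * a\<^sup>2 + 2 * b\<^sup>2" for a b :: real
    using zero_le_power2[of "a - b"] by (simp add: power2_eq_square algebra_simps)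
  have "(a + b) ^ 4 \<le> 8 * a ^ 4 + 8 * b ^ 4" for a b :: real
  proof -
    have "(a + b) ^ 4 = ((a + b)\<^sup>2)\<^sup>2" by simp
    also have "\<dots> \<le> (2 * a\<^sup>2 + 2 * b\<^sup>2)\<^sup>2" by (intro power_mono sq) simp
    also have "\<dots> \<le> 2 * (2 * a\<^sup>2)\<^sup>2 + 2 * (2 * b\<^sup>2)\<^sup>2" by (rule sq)
    finally show ?thesis by (simp add: power_mult_distrib)
  qed
  then show "AE x in M. norm ((f x + g x) ^ 4) \<le> norm (8 * f x ^ 4 + 8 * g x ^ 4)"
    by (auto intro!: order_trans[OF _ abs_ge_self])
qed (use int in auto)

lemma (in finite_measure) integrable_power4_sum:
  fixes f :: "'b \<Rightarrow> 'a \<Rightarrow> real"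
  assumes "finite A" "\<And>i. i \<in> A \<Longrightarrow> f i \<in> borel_measurable M"
    and "\<And>i. i \<in> A \<Longrightarrow> integrable M (\<lambda>x. f i x ^ 4)"
  shows "integrable M (\<lambda>x. (\<Sum>i\<in>A. f i x) ^ 4)"
  using assms by (induction A) (auto intro!: integrable_power4_add borel_measurable_sum)

section \<open>The i.i.d. field: stationarity and independence of sites\<close>

text \<open>The fourth moment serves the strong law; the third one, which it implies, controls the
  boundary error of the walk.\<close>

locale centered_law = real_distribution \<mu> for \<mu> :: "real measure" +
  assumes mean_zero: "expectation (\<lambda>x. x) = 0"
    and fourth_moment: "integrable \<mu> (\<lambda>x. x ^ 4)"
begin

definition field :: "(nat \<Rightarrow> real) measure" where
  "field = PiM {1::nat..} (\<lambda>_. \<mu>)"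

sublocale F: prob_space field
  unfolding field_def by (intro prob_space_PiM prob_space_axioms)

lemma measurable_site [measurable]: "1 \<le> n \<Longrightarrow> (\<lambda>h. h n) \<in> borel_measurable field"
  using measurable_component_singleton[of n "{1..}" "\<lambda>_. \<mu>"] unfolding field_def by simp

lemma distr_site: "1 \<le> n \<Longrightarrow> distr field \<mu> (\<lambda>h. h n) = \<mu>"
  unfolding field_def by (rule distr_PiM_component) (auto intro: prob_space_axioms)

lemma
  fixes f :: "real \<Rightarrow> real"
  assumes n: "1 \<le> n" and f: "f \<in> borel_measurable borel"
  shows integrable_site: "integrable field (\<lambda>h. f (h n)) \<longleftrightarrow> integrable \<mu> f"
    and expectation_site: "F.expectation (\<lambda>h. f (h n)) = expectation f"
proof -
  have m: "(\<lambda>h. h n) \<in> measurable field \<mu>" "f \<in> borel_measurable \<mu>"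
    using n f by (auto cong: measurable_cong_sets)
  show "integrable field (\<lambda>h. f (h n)) \<longleftrightarrow> integrable \<mu> f"
    using integrable_distr_eq[OF m] distr_site[OF n] by simp
  show "F.expectation (\<lambda>h. f (h n)) = expectation f"
    using integral_distr[OF m] distr_site[OF n] by simp
qed

text \<open>The coordinate map is the identity on the product space, so its law is the product of
  the site laws, which characterizes independence.\<close>

lemma indep_sites: "F.indep_vars (\<lambda>_. borel) (\<lambda>n h. h n) {1..}"
proof -
  have "distr field (PiM {1..} (\<lambda>_. \<mu>)) (\<lambda>h. \<lambda>n\<in>{1..}. h n) = PiM {1..} (\<lambda>n. distr field \<mu> (\<lambda>h. h n))"
    using distr_PiM_reindex[of "{1::nat..}" "\<lambda>_. \<mu>" "\<lambda>x. x" "{1..}"] prob_space_axioms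
    by (subst PiM_cong[OF refl distr_site]) (simp_all add: field_def)
  then have "F.indep_vars (\<lambda>_. \<mu>) (\<lambda>n h. h n) {1..}"
    by (subst F.indep_vars_iff_distr_eq_PiM') (auto simp: field_def)
  from F.indep_vars_compose2[OF this, of "\<lambda>_ x. x" "\<lambda>_. borel"] show ?thesis
    by simp
qed

text \<open>Reindexing a product of equal factors along the injection n -> k + n preserves it. The
  restriction is there because points of \<open>field\<close> are extensional, whereas the plain
  shift would take the value \<open>h k\<close> at site 0.\<close>

lemma
  fixes f :: "(nat \<Rightarrow> real) \<Rightarrow> real"
  assumes f: "f \<in> borel_measurable field"
  shows integrable_shift: "integrable field (\<lambda>h. f (\<lambda>n\<in>{1..}. h (k + n))) \<longleftrightarrow> integrable field f"
    and expectation_shift: "F.expectation (\<lambda>h. f (\<lambda>n\<in>{1..}. h (k + n))) = F.expectation f"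
proof -
  have d: "distr field field (\<lambda>h. \<lambda>n\<in>{1..}. h (k + n)) = field"
    using distr_PiM_reindex[of "{1::nat..}" "\<lambda>_. \<mu>" "\<lambda>n. k + n" "{1..}"] prob_space_axioms
    unfolding field_def by (auto simp: inj_on_def)
  have m: "(\<lambda>h. \<lambda>n\<in>{1..}. h (k + n)) \<in> measurable field field"
    unfolding field_def by (intro measurable_restrict measurable_component_singleton) auto
  show "integrable field (\<lambda>h. f (\<lambda>n\<in>{1..}. h (k + n))) \<longleftrightarrow> integrable field f"
    using integrable_distr_eq[OF m f] d by simp
  show "F.expectation (\<lambda>h. f (\<lambda>n\<in>{1..}. h (k + n))) = F.expectation f"
    using integral_distr[OF m f] d by simp
qed

section \<open>Moments, independence and averages of the blocks\<close>

lemma measurable_log_total_field [measurable]: "log_total e n \<in> borel_measurable field"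
  by (rule borel_measurable_log_total) simp

lemma log_total_shift: "log_total e m (\<lambda>n. h (k + n)) = log_total e m (\<lambda>n\<in>{1..}. h (k + n))"
  by (rule log_total_cong) simp

lemma integrable_abs_site_power4:
  assumes "1 \<le> n" shows "integrable field (\<lambda>h. (c + \<bar>h n\<bar>) ^ 4)"
proof (rule F.integrable_power4_add)
  show "integrable field (\<lambda>h. \<bar>h n\<bar> ^ 4)"
    using integrable_site[OF assms, of "\<lambda>x. x ^ 4"] fourth_moment by (simp add: power_even_abs)
qed (use assms in auto)

lemma integrable_log_total_power4:
  assumes e: "0 < e" "e \<le> 1"
  shows "integrable field (\<lambda>h. log_total e n h ^ 4)"
proof (rule Bochner_Integration.integrable_bound)
  have "integrable field (\<lambda>h. (\<Sum>k=1..n. ln ((1 + e) / e) + 2 + \<bar>h k\<bar>) ^ 4)"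
    by (rule F.integrable_power4_sum) (auto intro!: integrable_abs_site_power4)
  then show "integrable field (\<lambda>h. (1 + (\<Sum>k=1..n. ln ((1 + e) / e) + 2 + \<bar>h k\<bar>)) ^ 4)"
    by (intro F.integrable_power4_add borel_measurable_sum) auto
  have "log_total e n h ^ 4 \<le> (1 + (\<Sum>k=1..n. ln ((1 + e) / e) + 2 + \<bar>h k\<bar>)) ^ 4" for h
    using power_mono[OF log_total_bound[OF e, of n h], of 4] by (simp add: power_even_abs)
  then show "AE h in field. norm (log_total e n h ^ 4) \<le>
      norm ((1 + (\<Sum>k=1..n. ln ((1 + e) / e) + 2 + \<bar>h k\<bar>)) ^ 4)"
    by (auto simp: power_even_abs)
qed measurable

lemma integrable_log_total:
  assumes "0 < e" "e \<le> 1"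
  shows "integrable field (log_total e n)"
  using F.integrable_power_le_4[of "log_total e n" 1] integrable_log_total_power4[OF assms] by simp

text \<open>Block i depends on the sites m i + 1 to m i + m only, and these sets are disjoint for
  different i.\<close>

lemma indep_blocks:
  "F.indep_vars (\<lambda>_. borel) (\<lambda>i h. log_total e m (\<lambda>n. h (m * i + n))) UNIV"
proof -
  let ?K = "\<lambda>i. {m * i + 1..m * i + m}"
  have "disjoint_family ?K"
  proof -
    have *: False if "i < j" "m * i + 1 \<le> x" "x \<le> m * i + m" "m * j + 1 \<le> x" for i j x
    proof -
      have "m * Suc i \<le> m * j" using that(1) by (intro mult_le_mono2) simp
      then show False using that by simp
    qed
    show ?thesis
    proof (unfold disjoint_family_on_def, intro ballI impI)
      fix i j :: nat assume "i \<noteq> j"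
      then consider "i < j" | "j < i" by linarith
      then show "?K i \<inter> ?K j = {}" by cases (use *[of i j] *[of j i] in fastforce)+
    qed
  qed
  then have "F.indep_vars (\<lambda>j. PiM (?K j) (\<lambda>_. borel)) (\<lambda>j h. restrict (\<lambda>i. h i) (?K j)) UNIV"
    by (intro F.indep_vars_restrict[OF indep_sites]) auto
  then have "F.indep_vars (\<lambda>_. borel)
      (\<lambda>i h. log_total e m (\<lambda>n. restrict (\<lambda>i. h i) (?K i) (m * i + n))) UNIV"
    by (rule F.indep_vars_compose2[where Y = "\<lambda>i g. log_total e m (\<lambda>n. g (m * i + n))"])
       (auto intro!: borel_measurable_log_total measurable_component_singleton)
  moreover have "log_total e m (\<lambda>n. restrict (\<lambda>i. h i) (?K i) (m * i + n)) =
      log_total e m (\<lambda>n. h (m * i + n))" for i h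
    by (rule log_total_cong) simp
  ultimately show ?thesis by simp
qed

text \<open>The blocks are independent and, by stationarity, distributed as the first one; the
  strong law applies once the common mean g is subtracted.\<close>

lemma AE_block_averages:
  assumes e: "0 < e" "e \<le> 1"
  shows "AE h in field. (\<lambda>k. (\<Sum>i<k. log_total e m (\<lambda>n. h (m * i + n))) / real k)
    \<longlonglongrightarrow> F.expectation (log_total e m)"
proof -
  define g where "g = F.expectation (log_total e m)"
  define f where "f = (\<lambda>h. log_total e m h - g)"
  have [measurable]: "f \<in> borel_measurable field" unfolding f_def by measurable
  have f4: "integrable field (\<lambda>h. f h ^ 4)"
    unfolding f_def diff_conv_add_uminus
    by (rule F.integrable_power4_add) (auto intro: integrable_log_total_power4[OF e])
  have f1: "F.expectation f = 0"
    unfolding f_def using integrable_log_total[OF e] by (simp add: g_def F.prob_space)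
  have fs: "f (\<lambda>n. h (k + n)) = f (\<lambda>n\<in>{1..}. h (k + n))" for h k
    unfolding f_def by (simp only: log_total_shift)
  have "AE h in field. (\<lambda>k. (\<Sum>i<k. f (\<lambda>n. h (m * i + n))) / real k) \<longlonglongrightarrow> 0"
  proof (rule F.strong_law_fourth_moment)
    show "F.indep_vars (\<lambda>_. borel) (\<lambda>i h. f (\<lambda>n. h (m * i + n))) UNIV"
      unfolding f_def by (rule F.indep_vars_compose2[OF indep_blocks, of "\<lambda>_ x. x - g"]) simp
    show "integrable field (\<lambda>h. f (\<lambda>n. h (m * i + n)) ^ 4)" for i
      unfolding fs by (subst integrable_shift[of "\<lambda>h. f h ^ 4"]) (auto intro: f4)
    show "F.expectation (\<lambda>h. f (\<lambda>n. h (m * i + n))) = 0" for i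
      unfolding fs by (subst expectation_shift) (auto intro: f1)
    show "F.expectation (\<lambda>h. f (\<lambda>n. h (m * i + n)) ^ 4) \<le> F.expectation (\<lambda>h. f h ^ 4)" for i
      unfolding fs by (subst expectation_shift[of "\<lambda>h. f h ^ 4"]) auto
  qed
  then show ?thesis
  proof eventually_elim
    fix h assume "(\<lambda>k. (\<Sum>i<k. f (\<lambda>n. h (m * i + n))) / real k) \<longlonglongrightarrow> 0"
    then have "(\<lambda>k. (\<Sum>i<k. f (\<lambda>n. h (m * i + n))) / real k + g) \<longlonglongrightarrow> 0 + g"
      by (intro tendsto_add tendsto_const)
    moreover have "\<forall>\<^sub>F k in sequentially. (\<Sum>i<k. f (\<lambda>n. h (m * i + n))) / real k + g =
        (\<Sum>i<k. log_total e m (\<lambda>n. h (m * i + n))) / real k"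
      using eventually_gt_at_top[of 0]
      by eventually_elim (simp add: f_def sum_subtractf diff_divide_distrib)
    ultimately show "(\<lambda>k. (\<Sum>i<k. log_total e m (\<lambda>n. h (m * i + n))) / real k)
        \<longlonglongrightarrow> F.expectation (log_total e m)"
      by (simp add: tendsto_cong g_def)
  qed
qed

text \<open>The averages of the field converge by the strong law, and \<open>h n / real n\<close> is
  the difference of two consecutive averages up to a factor tending to 1.\<close>

lemma AE_site_sublinear: "AE h in field. (\<lambda>n. h n / real n) \<longlonglongrightarrow> 0"
proof -
  have "AE h in field. (\<lambda>n. (\<Sum>i<n. h (Suc i)) / real n) \<longlonglongrightarrow> 0"
  proof (rule F.strong_law_fourth_moment)
    show "F.indep_vars (\<lambda>_. borel) (\<lambda>i h. h (Suc i)) UNIV"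
    proof -
      have "F.indep_vars (\<lambda>j. PiM {Suc j} (\<lambda>_. borel)) (\<lambda>j h. restrict (\<lambda>i. h i) {Suc j}) UNIV"
        by (intro F.indep_vars_restrict[OF indep_sites]) (auto simp: disjoint_family_on_def)
      from F.indep_vars_compose2[OF this, of "\<lambda>j g. g (Suc j)" "\<lambda>_. borel"] show ?thesis
        by (simp add: measurable_component_singleton)
    qed
    show "integrable field (\<lambda>h. h (Suc i) ^ 4)" for i
      using integrable_site[of "Suc i" "\<lambda>x. x ^ 4"] fourth_moment by simp
    show "F.expectation (\<lambda>h. h (Suc i)) = 0" for i
      using expectation_site[of "Suc i" "\<lambda>x. x"] mean_zero by simp
    show "F.expectation (\<lambda>h. h (Suc i) ^ 4) \<le> expectation (\<lambda>x. x ^ 4)" for i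
      using expectation_site[of "Suc i" "\<lambda>x. x ^ 4"] by simp
  qed
  then show ?thesis
  proof eventually_elim
    fix h :: "nat \<Rightarrow> real"
    assume S: "(\<lambda>n. (\<Sum>i<n. h (Suc i)) / real n) \<longlonglongrightarrow> 0"
    have "(\<lambda>n. (\<Sum>i<Suc n. h (Suc i)) / real (Suc n) - (\<Sum>i<n. h (Suc i)) / real n * (real n / real (Suc n)))
        \<longlonglongrightarrow> 0 - 0 * 1"
      by (intro tendsto_diff tendsto_mult S LIMSEQ_n_over_Suc_n LIMSEQ_Suc[OF S])
    moreover have "(\<Sum>i<Suc n. h (Suc i)) / real (Suc n) - (\<Sum>i<n. h (Suc i)) / real n * (real n / real (Suc n))
        = h (Suc n) / real (Suc n)" for n
      by (cases "n = 0") (simp_all add: add_divide_distrib del: of_nat_Suc)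
    ultimately have "(\<lambda>n. h (Suc n) / real (Suc n)) \<longlonglongrightarrow> 0" by simp
    then show "(\<lambda>n. h n / real n) \<longlonglongrightarrow> 0" by (rule LIMSEQ_imp_Suc)
  qed
qed

section \<open>Almost sure convergence and the description operator\<close>

lemma ln_ising_Z_bound:
  assumes J: "0 \<le> J" and a: "a \<in> {-1, 1}" and b: "b \<in> {-1, 1}" and N: "0 < N"
  defines "e \<equiv> exp (- 2 * J)"
  shows "\<bar>ln (ising_Z N h a b J) - log_total e N h\<bar> \<le> ln ((1 + e) / e) + ln (2 / e) + 1 + 2 * \<bar>h N\<bar>"
proof -
  have e: "0 < e" "e \<le> 1" using J by (auto simp: e_def)
  note bd = ln_transfer_component[OF e, of "of_bool (a = 1)" "of_bool (a = -1)" N h]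
  show ?thesis
    using bd a b N by (auto simp: ising_Z_eq_transfer[OF a, of J h N, folded e_def])
qed

lemma AE_free_energy:
  assumes J: "0 \<le> J"
  defines "e \<equiv> exp (- 2 * J)"
  obtains F where "(\<lambda>m. F.expectation (log_total e m) / real m) \<longlonglongrightarrow> F"
    and "AE h in field. \<forall>a\<in>{-1, 1}. \<forall>b\<in>{-1, 1}. (\<lambda>N. 1 / real N * ln (ising_Z N h a b J)) \<longlonglongrightarrow> F"
proof -
  have e: "0 < e" "e \<le> 1" using J by (auto simp: e_def)
  define C where "C = ln ((1 + e) / e)"
  have C: "0 \<le> C" using e unfolding C_def by (intro ln_ge_zero) (simp add: field_simps)
  define g where "g = (\<lambda>m. F.expectation (log_total e m))"
  \<comment> \<open>All almost sure properties are collected in one event; only countably many m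
    occur, so it still has full measure.\<close>
  define good where "good = (\<lambda>h. (\<lambda>n. h n / real n) \<longlonglongrightarrow> 0 \<and>
    (\<forall>m. (\<lambda>k. (\<Sum>i<k. log_total e m (\<lambda>n. h (m * i + n))) / real k) \<longlonglongrightarrow> g m))"
  have good: "AE h in field. good h"
    unfolding good_def g_def using AE_site_sublinear AE_block_averages[OF e] by (auto simp: AE_all_countable)
  have lim: "\<exists>F. (\<lambda>n. log_total e n h / real n) \<longlonglongrightarrow> F \<and> (\<lambda>m. g m / real m) \<longlonglongrightarrow> F" if "good h" for h
    using that C unfolding good_def
    by (intro block_averages_tendsto[where h = h and C = C and D = "C + 2"
          and Y = "\<lambda>m i. log_total e m (\<lambda>n. h (m * i + n))"])
       (auto simp: C_def intro: log_total_blocks[OF e] log_total_step[OF e])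
  obtain h0 where "good h0"
  proof (rule ccontr)
    assume "\<not> thesis"
    with that have "\<not> good h" for h by blast
    with good have "AE h in field. False" by (auto elim: eventually_mono)
    then show False by simp
  qed
  \<comment> \<open>Since g does not depend on h, one good sample already yields the limit F, and
    every other good sample must share it.\<close>
  then obtain F where F: "(\<lambda>m. g m / real m) \<longlonglongrightarrow> F" using lim by blast
  have Z: "(\<lambda>N. 1 / real N * ln (ising_Z N h a b J)) \<longlonglongrightarrow> F"
    if h: "good h" and ab: "a \<in> {-1, 1}" "b \<in> {-1, 1}" for h a b
  proof -
    have L: "(\<lambda>n. log_total e n h / real n) \<longlonglongrightarrow> F"
      using lim[OF h] F LIMSEQ_unique by blast
    define D where "D = C + ln (2 / e) + 1"
    have "(\<lambda>N. ln (ising_Z N h a b J) / real N - log_total e N h / real N) \<longlonglongrightarrow> 0"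
    proof (rule Lim_null_comparison)
      show "(\<lambda>N. D / real N + 2 * \<bar>h N / real N\<bar>) \<longlonglongrightarrow> 0"
        using tendsto_add[OF lim_const_over_n[of D] tendsto_mult_left[OF tendsto_rabs_zero, of _ _ 2]] h
        unfolding good_def by fastforce
      show "\<forall>\<^sub>F N in sequentially. norm (ln (ising_Z N h a b J) / real N - log_total e N h / real N)
          \<le> D / real N + 2 * \<bar>h N / real N\<bar>"
        using eventually_gt_at_top[of 0]
      proof eventually_elim
        fix N :: nat assume N: "0 < N"
        have "\<bar>ln (ising_Z N h a b J) - log_total e N h\<bar> / real N \<le> (D + 2 * \<bar>h N\<bar>) / real N"
          using ln_ising_Z_bound[OF J ab N, of h] unfolding D_def C_def e_def
          by (intro divide_right_mono) auto
        then show "norm (ln (ising_Z N h a b J) / real N - log_total e N h / real N)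
          \<le> D / real N + 2 * \<bar>h N / real N\<bar>"
          by (simp add: add_divide_distrib abs_divide flip: diff_divide_distrib)
      qed
    qed
    from tendsto_add[OF this L] show ?thesis by simp
  qed
  show ?thesis
  proof (rule that)
    show "(\<lambda>m. F.expectation (log_total e m) / real m) \<longlonglongrightarrow> F" using F by (simp add: g_def)
    show "AE h in field. \<forall>a\<in>{-1, 1}. \<forall>b\<in>{-1, 1}. (\<lambda>N. 1 / real N * ln (ising_Z N h a b J)) \<longlonglongrightarrow> F"
      using good by eventually_elim (intro ballI Z)
  qed
qed

text \<open>Existence for the description operator is \<open>AE_free_energy\<close>. Uniqueness
  holds because two almost sure limits agree at almost every sample and are constants on a
  probability space. The limit of expectations is the form to which the second-moment computation
  below applies.\<close>

theorem expectation_log_total_tendsto: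
  assumes J: "0 \<le> J"
  shows "(\<lambda>m. F.expectation (log_total (exp (- 2 * J)) m) / real m) \<longlonglongrightarrow> free_energy \<mu> J"
proof -
  obtain F where F: "(\<lambda>m. F.expectation (log_total (exp (- 2 * J)) m) / real m) \<longlonglongrightarrow> F"
    and AE: "AE h in field. \<forall>a\<in>{-1, 1}. \<forall>b\<in>{-1, 1}. (\<lambda>N. 1 / real N * ln (ising_Z N h a b J)) \<longlonglongrightarrow> F"
    using AE_free_energy[OF J] .
  have "free_energy \<mu> J = F"
    unfolding free_energy_def field_def[symmetric]
  proof (rule the_equality, rule AE)
    fix G
    assume "AE h in field. \<forall>a\<in>{-1, 1}. \<forall>b\<in>{-1, 1}. (\<lambda>N. 1 / real N * ln (ising_Z N h a b J)) \<longlonglongrightarrow> G"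
    with AE have "AE h in field. G = F"
    proof eventually_elim
      case (elim h)
      then show ?case by (meson LIMSEQ_unique insertI1)
    qed
    then show "G = F" by simp
  qed
  with F show ?thesis by simp
qed

end

section \<open>The reflected walk\<close>

text \<open>The argument is the signed distance to a barrier, positive on the inner side. The value
  is a smoothed negative part: exponentially small inside, nearly linear in the overshoot
  outside.\<close>

definition softplus :: "real \<Rightarrow> real" where
  "softplus x = ln (1 + exp (- x))"

lemma softplus_nonneg: "0 \<le> softplus x"
  unfolding softplus_def by (intro ln_ge_zero) simp

lemma softplus_le_exp: "softplus x \<le> exp (- x)"
  unfolding softplus_def by (rule ln_add_one_self_le_self) simp

lemma softplus_le:
  assumes "0 \<le> t" "- t \<le> x"
  shows "softplus x \<le> 1 + t"
proof -
  have "1 + exp (- x) \<le> exp t + exp t" using assms by (intro add_mono) auto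
  also have "\<dots> \<le> exp (1 + t)"
  proof -
    have "(2::real) \<le> exp 1" using exp_ge_add_one_self[of 1] by simp
    from mult_right_mono[OF this, of "exp t"] show ?thesis by (simp add: exp_add)
  qed
  finally have "softplus x \<le> ln (exp (1 + t))"
    unfolding softplus_def by (intro ln_mono) (auto simp: add_pos_pos)
  then show ?thesis by simp
qed

text \<open>AM-GM trades the quadratic boundary error for a small multiple of the local time \<open>softplus x\<close>
  plus a third moment of the overshoot \<open>t\<close>.\<close>

lemma boundary_error_le:
  assumes l: "0 < l" and t: "0 \<le> t" "- t \<le> x"
  shows "2 * \<bar>x\<bar> * softplus x + (softplus x)\<^sup>2 \<le> l * softplus x + 9 / 2 * (1 + t) ^ 3 / l"
proof -
  define a where "a = softplus x"
  \<comment> \<open>Since w dominates both |x| and a, the two quadratic terms together are at most 3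
    w a.\<close>
  define w where "w = max \<bar>x\<bar> a"
  have a0: "0 \<le> a" by (simp add: a_def softplus_nonneg)
  have w: "\<bar>x\<bar> \<le> w" "a \<le> w" "0 \<le> w" by (auto simp: w_def)
  have one: "1 \<le> (1 + t) ^ 3" using t by (intro one_le_power) simp
  \<comment> \<open>Inside the barrier the exponential decay of a beats x^2; outside, both |x| and a
    are at most 1 + t.\<close>
  have w2a: "w\<^sup>2 * a \<le> 2 * (1 + t) ^ 3"
  proof (cases "0 \<le> x")
    case True
    have ae: "a \<le> exp (- x)" by (simp add: a_def softplus_le_exp)
    have "exp (- x) \<le> 1" using True by simp
    with ae have a1: "a \<le> 1" by linarith
    show ?thesis
    proof (cases "x \<le> 1")
      case True
      then have "w \<le> 1" using a1 \<open>0 \<le> x\<close> by (simp add: w_def)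
      then have "w\<^sup>2 * a \<le> 1 * 1" using w a0 a1 by (intro mult_mono power_le_one) auto
      then show ?thesis using one by linarith
    next
      case False
      then have "w = x" using a1 by (simp add: w_def)
      have "x\<^sup>2 / 2 \<le> exp x"
        using exp_lower_Taylor_quadratic[OF \<open>0 \<le> x\<close>] \<open>0 \<le> x\<close> by linarith
      then have "x\<^sup>2 * exp (- x) \<le> 2" by (simp add: exp_minus field_simps)
      moreover have "x\<^sup>2 * a \<le> x\<^sup>2 * exp (- x)" by (intro mult_left_mono ae) simp
      ultimately show ?thesis using one unfolding \<open>w = x\<close> by linarith
    qed
  next
    case False
    have "a \<le> 1 + t" unfolding a_def by (rule softplus_le[OF t])
    moreover have "w \<le> 1 + t" using False t calculation by (simp add: w_def)
    ultimately have "w\<^sup>2 * a \<le> (1 + t)\<^sup>2 * (1 + t)" using w a0 by (intro mult_mono power_mono) auto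
    also have "\<dots> = (1 + t) ^ 3" by (simp add: power2_eq_square power3_eq_cube)
    finally show ?thesis using one by linarith
  qed
  have "2 * \<bar>x\<bar> * a + a\<^sup>2 \<le> 2 * w * a + w * a"
    using w a0 by (intro add_mono) (auto intro!: mult_right_mono mult_left_mono simp: power2_eq_square)
  also have "\<dots> = a * (3 * w)" by simp
  \<comment> \<open>This is the square of l - 3 w / 2 being nonnegative, divided by l. With the
    bound 2 (1 + t)^3 on w^2 a, the coefficient 9 / 4 becomes 9 / 2.\<close>
  also have "\<dots> \<le> a * (l + 9 / 4 * w\<^sup>2 / l)"
  proof (rule mult_left_mono[OF _ a0])
    have "0 \<le> (l - 3 / 2 * w)\<^sup>2 / l" using l by simp
    also have "\<dots> = l + 9 / 4 * w\<^sup>2 / l - 3 * w"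
      using l by (simp add: field_simps power2_eq_square)
    finally show "3 * w \<le> l + 9 / 4 * w\<^sup>2 / l" by simp
  qed
  also have "\<dots> = l * a + 9 / 4 * (w\<^sup>2 * a) / l" by (simp add: algebra_simps)
  also have "\<dots> \<le> l * a + 9 / 4 * (2 * (1 + t) ^ 3) / l"
    using w2a l by (intro add_mono divide_right_mono mult_left_mono) auto
  finally show ?thesis by (simp add: a_def)
qed

text \<open>With eps = exp (- 2 J) the quantity is the logarithm of (exp x + eps) / (1 + eps exp x),
  and this Moebius map sends the positive half-line into the interval from eps to 1 / eps.\<close>

lemma clipped_le:
  assumes J: "0 \<le> J"
  shows "\<bar>x + softplus (x + 2 * J) - softplus (2 * J - x)\<bar> \<le> 2 * J"
proof -
  have pos: "0 < exp x + exp (- 2 * J)" "0 < 1 + exp (x - 2 * J)" by (auto intro: add_pos_pos)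
  have A: "x + softplus (x + 2 * J) = ln (exp x + exp (- 2 * J))"
  proof -
    have "exp x + exp (- 2 * J) = exp x * (1 + exp (- (x + 2 * J)))"
      by (simp add: distrib_left flip: exp_add)
    moreover have "0 < 1 + exp (- (x + 2 * J))" by (intro add_pos_pos) auto
    ultimately show ?thesis by (simp only: softplus_def ln_mult_pos exp_gt_zero ln_exp)
  qed
  have B: "softplus (2 * J - x) = ln (1 + exp (x - 2 * J))" by (simp add: softplus_def)
  have JJ: "exp (- 2 * J) \<le> exp (2 * J)" using J by simp
  have "ln (exp x + exp (- 2 * J)) \<le> ln (exp (2 * J) * (1 + exp (x - 2 * J)))"
    using pos JJ by (intro ln_mono) (auto simp: distrib_left simp flip: exp_add)
  also have "\<dots> = 2 * J + ln (1 + exp (x - 2 * J))" using pos by (simp add: ln_mult)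
  finally have up: "ln (exp x + exp (- 2 * J)) \<le> 2 * J + ln (1 + exp (x - 2 * J))" .
  have "- 2 * J + ln (1 + exp (x - 2 * J)) = ln (exp (- 2 * J) * (1 + exp (x - 2 * J)))"
    using pos by (simp add: ln_mult)
  also have "\<dots> \<le> ln (exp x + exp (- 2 * J))"
    using pos J by (intro ln_mono mult_pos_pos) (auto simp: distrib_left simp flip: exp_add)
  finally show ?thesis using up A B by linarith
qed

section \<open>Dynamics of the log-ratio and of the geometric mean\<close>

text \<open>\<open>log_ratio\<close>, \<open>log_geom\<close>, \<open>push_up\<close> and
  \<open>push_down\<close> are the quantities L, A, a and b of the introductory text.\<close>

definition log_ratio :: "real \<Rightarrow> nat \<Rightarrow> (nat \<Rightarrow> real) \<Rightarrow> real" where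
  "log_ratio J n h = ln (fst (transfer (exp (- 2 * J)) h (1, 1) n)) - ln (snd (transfer (exp (- 2 * J)) h (1, 1) n))"

definition log_geom :: "real \<Rightarrow> nat \<Rightarrow> (nat \<Rightarrow> real) \<Rightarrow> real" where
  "log_geom J n h = (ln (fst (transfer (exp (- 2 * J)) h (1, 1) n)) + ln (snd (transfer (exp (- 2 * J)) h (1, 1) n))) / 2"

definition push_up :: "real \<Rightarrow> nat \<Rightarrow> (nat \<Rightarrow> real) \<Rightarrow> real" where
  "push_up J n h = softplus (log_ratio J n h + 2 * J)"

definition push_down :: "real \<Rightarrow> nat \<Rightarrow> (nat \<Rightarrow> real) \<Rightarrow> real" where
  "push_down J n h = softplus (2 * J - log_ratio J n h)"

text \<open>Taking the old entry p out of p + e q leaves the factor 1 + e q / p, and e q / p is exp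
  (- (L + 2 J)); the other entry is symmetric.\<close>

lemma ln_transfer_Suc:
  fixes J h n
  defines "e \<equiv> exp (- 2 * J)"
  shows "ln (fst (transfer e h (1, 1) (Suc n))) = h (Suc n) + ln (fst (transfer e h (1, 1) n)) + push_up J n h"
    and "ln (snd (transfer e h (1, 1) (Suc n))) = - h (Suc n) + ln (snd (transfer e h (1, 1) n)) + push_down J n h"
proof -
  define p q where "p = fst (transfer e h (1, 1) n)" and "q = snd (transfer e h (1, 1) n)"
  have pos: "0 < p" "0 < q" using transfer_pos[of e "(1, 1)" h n] by (auto simp: p_def q_def e_def)
  have L: "log_ratio J n h = ln p - ln q" by (simp add: log_ratio_def p_def q_def e_def)
  have "exp (- (ln p - ln q + 2 * J)) = e * q / p"
    using pos by (simp add: e_def exp_minus exp_add exp_diff field_simps)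
  moreover have "exp (- (2 * J - (ln p - ln q))) = e * p / q"
    using pos by (simp add: e_def exp_minus exp_add exp_diff field_simps)
  ultimately have push: "push_up J n h = ln (1 + e * q / p)" "push_down J n h = ln (1 + e * p / q)"
    by (simp_all add: push_up_def push_down_def softplus_def L)
  have e0: "0 < e" by (simp add: e_def)
  have "p + e * q = p * (1 + e * q / p)" "e * p + q = q * (1 + e * p / q)" using pos by (auto simp: field_simps)
  moreover have "0 < 1 + e * q / p" "0 < 1 + e * p / q" using pos e0 by (auto intro!: add_pos_pos)
  ultimately have "ln (p + e * q) = ln p + push_up J n h" "ln (e * p + q) = ln q + push_down J n h"
    unfolding push using pos by (simp_all only: ln_mult_pos)
  moreover have "0 < p + e * q" "0 < e * p + q" using pos e0 by (auto intro!: add_pos_pos)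
  ultimately show "ln (fst (transfer e h (1, 1) (Suc n))) = h (Suc n) + ln (fst (transfer e h (1, 1) n)) + push_up J n h"
    "ln (snd (transfer e h (1, 1) (Suc n))) = - h (Suc n) + ln (snd (transfer e h (1, 1) n)) + push_down J n h"
    by (simp_all add: ln_mult_pos flip: p_def q_def)
qed

lemma log_ratio_0 [simp]: "log_ratio J 0 h = 0"
  by (simp add: log_ratio_def)

lemma log_geom_0 [simp]: "log_geom J 0 h = 0"
  by (simp add: log_geom_def)

lemma log_ratio_Suc:
  "log_ratio J (Suc n) h = 2 * h (Suc n) + (log_ratio J n h + push_up J n h - push_down J n h)"
  unfolding log_ratio_def ln_transfer_Suc by simp

lemma log_geom_Suc: "log_geom J (Suc n) h = log_geom J n h + (push_up J n h + push_down J n h) / 2"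
  unfolding log_geom_def ln_transfer_Suc by (simp add: add_divide_distrib)

text \<open>The field has no site 0, where the product measure puts the value \<open>undefined\<close>.\<close>

definition overshoot :: "nat \<Rightarrow> (nat \<Rightarrow> real) \<Rightarrow> real" where
  "overshoot n h = (if n = 0 then 0 else 2 * \<bar>h n\<bar>)"

lemma overshoot_nonneg: "0 \<le> overshoot n h"
  by (simp add: overshoot_def)

text \<open>Before the new field is added, the reflected position lies within 2 J of 0 by
  \<open>clipped_le\<close>; the field then moves it by 2 h. At n = 0 the walk sits at 0.\<close>

lemma log_ratio_bound:
  assumes "0 \<le> J"
  shows "\<bar>log_ratio J n h\<bar> \<le> 2 * J + overshoot n h"
proof (cases n)
  case (Suc m)
  then show ?thesis
    using clipped_le[OF assms, of "log_ratio J m h"]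
    by (simp add: log_ratio_Suc overshoot_def push_up_def push_down_def)
qed (use assms in \<open>simp add: overshoot_def\<close>)

lemma push_bound:
  assumes "0 \<le> J"
  shows "push_up J n h \<le> 1 + overshoot n h" "push_down J n h \<le> 1 + overshoot n h"
  unfolding push_up_def push_down_def
  using log_ratio_bound[OF assms, of n h] overshoot_nonneg[of n h] by (auto intro!: softplus_le)

lemma push_nonneg: "0 \<le> push_up J n h" "0 \<le> push_down J n h"
  by (simp_all add: push_up_def push_down_def softplus_nonneg)

text \<open>What remains when 2 L (a - b) + (a - b)^2 is written as - 4 J (a + b) plus an error.
  Each push is multiplied by the distance to its own barrier, and on the inner side that distance is
  large only where the push is exponentially small.\<close>

definition boundary_error :: "real \<Rightarrow> nat \<Rightarrow> (nat \<Rightarrow> real) \<Rightarrow> real" where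
  "boundary_error J n h = 2 * (log_ratio J n h + 2 * J) * push_up J n h
     + 2 * (2 * J - log_ratio J n h) * push_down J n h + (push_up J n h - push_down J n h)\<^sup>2"

lemma log_ratio_Suc_square:
  "(log_ratio J (Suc n) h)\<^sup>2 = (log_ratio J n h)\<^sup>2 + 4 * (h (Suc n))\<^sup>2
     + 4 * (h (Suc n) * (log_ratio J n h + push_up J n h - push_down J n h))
     - 4 * J * (push_up J n h + push_down J n h) + boundary_error J n h"
  unfolding log_ratio_Suc boundary_error_def by (simp add: power2_eq_square algebra_simps)

text \<open>\<open>boundary_error_le\<close> applies at both barriers with the overshoot as t; the
  cross term of the square has a favourable sign because both pushes are nonnegative.\<close>

lemma boundary_error_bound:
  assumes J: "0 \<le> J" and l: "0 < l"
  shows "\<bar>boundary_error J n h\<bar> \<le> l * (push_up J n h + push_down J n h) + 9 * (1 + overshoot n h) ^ 3 / l"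
proof -
  let ?x = "log_ratio J n h + 2 * J" and ?y = "2 * J - log_ratio J n h"
  let ?a = "push_up J n h" and ?b = "push_down J n h"
  have t: "- overshoot n h \<le> ?x" "- overshoot n h \<le> ?y" using log_ratio_bound[OF J, of n h] by auto
  have "\<bar>2 * ?x * ?a\<bar> = 2 * \<bar>?x\<bar> * ?a" "\<bar>2 * ?y * ?b\<bar> = 2 * \<bar>?y\<bar> * ?b"
    using push_nonneg[of J n h] by (simp_all only: abs_mult abs_numeral abs_of_nonneg)
  moreover have "(?a - ?b)\<^sup>2 \<le> ?a\<^sup>2 + ?b\<^sup>2"
    using mult_nonneg_nonneg[OF push_nonneg, of J n h J n h] by (simp add: power2_eq_square algebra_simps)
  moreover have "0 \<le> (?a - ?b)\<^sup>2" by simp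
  ultimately have "\<bar>boundary_error J n h\<bar> \<le> (2 * \<bar>?x\<bar> * ?a + ?a\<^sup>2) + (2 * \<bar>?y\<bar> * ?b + ?b\<^sup>2)"
    unfolding boundary_error_def by linarith
  also have "\<dots> \<le> (l * ?a + 9 / 2 * (1 + overshoot n h) ^ 3 / l) + (l * ?b + 9 / 2 * (1 + overshoot n h) ^ 3 / l)"
    unfolding push_up_def push_down_def
    by (intro add_mono boundary_error_le l overshoot_nonneg t)
  finally show ?thesis by (simp add: algebra_simps)
qed

lemma log_geom_near_log_total:
  assumes J: "0 \<le> J" and n: "0 < n"
  defines "e \<equiv> exp (- 2 * J)"
  shows "\<bar>log_geom J n h - log_total e n h\<bar> \<le> ln ((1 + e) / e) + ln (2 / e) + 1 + 2 * \<bar>h n\<bar>"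
proof -
  have e: "0 < e" "e \<le> 1" using J by (auto simp: e_def)
  show ?thesis
    using ln_transfer_component[OF e, of 1 1 n h] n
    unfolding log_geom_def e_def[symmetric] by (simp add: field_simps)
qed

lemma log_ratio_cong:
  "(\<And>k. k \<in> {1..n} \<Longrightarrow> h k = h' k) \<Longrightarrow> log_ratio J n h = log_ratio J n h'"
  unfolding log_ratio_def using transfer_cong[of n h h'] by metis

lemma borel_measurable_log_ratio:
  assumes "\<And>k. k \<in> {1..n} \<Longrightarrow> (\<lambda>x. H x k) \<in> borel_measurable M"
  shows "(\<lambda>x. log_ratio J n (H x)) \<in> borel_measurable M"
proof -
  have [measurable]: "(\<lambda>x. fst (transfer (exp (- 2 * J)) (H x) (1, 1) n)) \<in> borel_measurable M"
    "(\<lambda>x. snd (transfer (exp (- 2 * J)) (H x) (1, 1) n)) \<in> borel_measurable M"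
    using borel_measurable_transfer[of n H M "exp (- 2 * J)" "(1, 1)"] assms by auto
  show ?thesis unfolding log_ratio_def by measurable
qed

lemma borel_measurable_softplus [measurable]: "softplus \<in> borel_measurable borel"
  unfolding softplus_def by measurable

section \<open>Expected balance of the squared log-ratio\<close>

context centered_law
begin

lemma measurable_log_ratio_field [measurable]: "log_ratio J n \<in> borel_measurable field"
  by (rule borel_measurable_log_ratio) simp

lemma measurable_push_field [measurable]:
  "push_up J n \<in> borel_measurable field" "push_down J n \<in> borel_measurable field"
  unfolding push_up_def push_down_def by measurable

lemma measurable_overshoot_field [measurable]: "overshoot n \<in> borel_measurable field"
  unfolding overshoot_def[abs_def] by (cases n) simp_all

lemma measurable_boundary_error_field [measurable]: "boundary_error J n \<in> borel_measurable field"
  unfolding boundary_error_def by measurable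

lemma integrable_site_power:
  assumes "k \<le> 4" shows "integrable \<mu> (\<lambda>x. (1 + 2 * \<bar>x\<bar>) ^ k)" "integrable \<mu> (\<lambda>x. x ^ k)"
proof -
  have "integrable \<mu> (\<lambda>x. (1 + 2 * \<bar>x\<bar>) ^ 4)"
    by (rule integrable_power4_add) (use fourth_moment in \<open>auto simp: power_mult_distrib power_even_abs\<close>)
  then show "integrable \<mu> (\<lambda>x. (1 + 2 * \<bar>x\<bar>) ^ k)"
    by (rule integrable_power_le_4[OF _ _ assms, rotated]) simp
  show "integrable \<mu> (\<lambda>x. x ^ k)"
    by (rule integrable_power_le_4[OF _ fourth_moment assms]) simp
qed

text \<open>The moment is bounded by that of the site law and need not equal it because of n = 0,
  where the overshoot is 0.\<close>

lemma
  assumes "k \<le> 4"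
  shows integrable_overshoot: "integrable field (\<lambda>h. (1 + overshoot n h) ^ k)"
    and expectation_overshoot: "F.expectation (\<lambda>h. (1 + overshoot n h) ^ k) \<le> expectation (\<lambda>x. (1 + 2 * \<bar>x\<bar>) ^ k)"
proof -
  have "integrable field (\<lambda>h. (1 + overshoot n h) ^ k) \<and>
    F.expectation (\<lambda>h. (1 + overshoot n h) ^ k) \<le> expectation (\<lambda>x. (1 + 2 * \<bar>x\<bar>) ^ k)"
  proof (cases "n = 0")
    case True
    have "expectation (\<lambda>x. 1) \<le> expectation (\<lambda>x. (1 + 2 * \<bar>x\<bar>) ^ k)"
      by (intro integral_mono integrable_site_power assms) auto
    then show ?thesis using True prob_space by (simp add: overshoot_def F.prob_space)
  next
    case False
    then show ?thesis
      using integrable_site[of n "\<lambda>x. (1 + 2 * \<bar>x\<bar>) ^ k"] expectation_site[of n "\<lambda>x. (1 + 2 * \<bar>x\<bar>) ^ k"]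
        integrable_site_power(1)[OF assms]
      by (simp add: overshoot_def)
  qed
  then show "integrable field (\<lambda>h. (1 + overshoot n h) ^ k)"
    "F.expectation (\<lambda>h. (1 + overshoot n h) ^ k) \<le> expectation (\<lambda>x. (1 + 2 * \<bar>x\<bar>) ^ k)" by auto
qed

lemma integrable_push:
  assumes "0 \<le> J"
  shows "integrable field (push_up J n)" "integrable field (push_down J n)"
proof -
  have i: "integrable field (\<lambda>h. 1 + overshoot n h)" using integrable_overshoot[of 1 n] by simp
  show "integrable field (push_up J n)" "integrable field (push_down J n)"
    by (rule Bochner_Integration.integrable_bound[OF i];
        use push_bound[OF assms, of n] push_nonneg[of J n] overshoot_nonneg[of n] in \<open>simp add: add_nonneg_nonneg\<close>)+
qed

lemma integrable_boundary_error:
  assumes "0 \<le> J"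
  shows "integrable field (boundary_error J n)"
proof (rule Bochner_Integration.integrable_bound)
  show "integrable field (\<lambda>h. 1 * (push_up J n h + push_down J n h) + 9 * (1 + overshoot n h) ^ 3 / 1)"
    using integrable_push[OF assms, of n] integrable_overshoot[of 3 n] by simp
  show "AE h in field. norm (boundary_error J n h)
      \<le> norm (1 * (push_up J n h + push_down J n h) + 9 * (1 + overshoot n h) ^ 3 / 1)"
    using boundary_error_bound[OF assms, of 1 n]
    by (intro AE_I2) (simp only: real_norm_def, blast intro: order_trans[OF _ abs_ge_self] zero_less_one)
qed measurable

text \<open>The bound is uniform in n, so this term disappears from the balance after division by
  n.\<close>

lemma
  assumes J: "0 \<le> J"
  shows integrable_log_ratio_square: "integrable field (\<lambda>h. (log_ratio J n h)\<^sup>2)"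
    and expectation_log_ratio_square:
      "F.expectation (\<lambda>h. (log_ratio J n h)\<^sup>2) \<le> (2 * J + 1)\<^sup>2 * expectation (\<lambda>x. (1 + 2 * \<bar>x\<bar>)\<^sup>2)"
proof -
  have bd: "(log_ratio J n h)\<^sup>2 \<le> (2 * J + 1)\<^sup>2 * (1 + overshoot n h)\<^sup>2" for h
  proof -
    have "\<bar>log_ratio J n h\<bar> \<le> (2 * J + 1) * (1 + overshoot n h)"
      using log_ratio_bound[OF J, of n h] mult_nonneg_nonneg[OF J overshoot_nonneg[of n h]]
      by (simp add: algebra_simps)
    from power_mono[OF this, of 2] show ?thesis by (simp add: power_mult_distrib)
  qed
  have int: "integrable field (\<lambda>h. (2 * J + 1)\<^sup>2 * (1 + overshoot n h)\<^sup>2)"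
    by (intro integrable_mult_right integrable_overshoot) simp
  show i: "integrable field (\<lambda>h. (log_ratio J n h)\<^sup>2)"
    using bd by (intro Bochner_Integration.integrable_bound[OF int]) auto
  have "F.expectation (\<lambda>h. (log_ratio J n h)\<^sup>2) \<le> F.expectation (\<lambda>h. (2 * J + 1)\<^sup>2 * (1 + overshoot n h)\<^sup>2)"
    by (intro integral_mono i int bd)
  also have "\<dots> \<le> (2 * J + 1)\<^sup>2 * expectation (\<lambda>x. (1 + 2 * \<bar>x\<bar>)\<^sup>2)"
    using expectation_overshoot[of 2 n] by (simp add: mult_left_mono)
  finally show "F.expectation (\<lambda>h. (log_ratio J n h)\<^sup>2) \<le> (2 * J + 1)\<^sup>2 * expectation (\<lambda>x. (1 + 2 * \<bar>x\<bar>)\<^sup>2)" .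
qed

text \<open>The factor c depends on the sites 1 to n only, and site n + 1 is centred and independent
  of them, so the cross term of the square is a martingale difference. Integrability of c comes from
  the reflection, which keeps it within 2 J.\<close>

lemma
  assumes J: "0 \<le> J"
  defines "c \<equiv> \<lambda>n h. log_ratio J n h + push_up J n h - push_down J n h"
  shows integrable_site_times_past: "integrable field (\<lambda>h. h (Suc n) * c n h)"
    and expectation_site_times_past: "F.expectation (\<lambda>h. h (Suc n) * c n h) = 0"
proof -
  \<comment> \<open>The source space is arbitrary because the independence argument requires
    measurability of c on the finite product over the sites 1 to n.\<close>
  have cm: "(\<lambda>x. c n (H x)) \<in> borel_measurable N"
    if "\<And>k. k \<in> {1..n} \<Longrightarrow> (\<lambda>x. H x k) \<in> borel_measurable N" for H and N :: "'z measure"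
  proof -
    note [measurable] = borel_measurable_log_ratio[of n H N J, OF that]
    show ?thesis unfolding c_def push_up_def push_down_def by measurable
  qed
  have "F.indep_var (PiM {Suc n} (\<lambda>_. borel)) (\<lambda>h. restrict (\<lambda>i. h i) {Suc n})
      (PiM {1..n} (\<lambda>_. borel)) (\<lambda>h. restrict (\<lambda>i. h i) {1..n})"
    by (intro F.indep_var_restrict[OF indep_sites]) auto
  then have "F.indep_var borel ((\<lambda>g. g (Suc n)) \<circ> (\<lambda>h. restrict (\<lambda>i. h i) {Suc n}))
      borel (c n \<circ> (\<lambda>h. restrict (\<lambda>i. h i) {1..n}))"
    by (rule F.indep_var_compose) (auto intro!: cm measurable_component_singleton)
  moreover have "c n (restrict (\<lambda>i. h i) {1..n}) = c n h" for h
    unfolding c_def push_up_def push_down_def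
    using log_ratio_cong[of n "restrict (\<lambda>i. h i) {1..n}" h J] by simp
  ultimately have ind: "F.indep_var borel (\<lambda>h. h (Suc n)) borel (c n)"
    by (simp add: comp_def)
  have c: "integrable field (c n)"
    unfolding c_def using clipped_le[OF J, of "log_ratio J n _"]
    by (intro F.integrable_const_bound[where B = "2 * J"]) (auto simp: push_up_def push_down_def)
  have h: "integrable field (\<lambda>h. h (Suc n))"
    using integrable_site[of "Suc n" "\<lambda>x. x"] integrable_site_power(2)[of 1] by simp
  show "integrable field (\<lambda>h. h (Suc n) * c n h)"
    by (rule F.indep_var_integrable[OF ind h c])
  have "F.expectation (\<lambda>h. h (Suc n)) = 0"
    using expectation_site[of "Suc n" "\<lambda>x. x"] mean_zero by simp
  then show "F.expectation (\<lambda>h. h (Suc n) * c n h) = 0"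
    using F.indep_var_lebesgue_integral[OF ind h c] by simp
qed

lemma expectation_log_ratio_Suc_square:
  assumes J: "0 \<le> J"
  shows "F.expectation (\<lambda>h. (log_ratio J (Suc n) h)\<^sup>2) = F.expectation (\<lambda>h. (log_ratio J n h)\<^sup>2)
    + 4 * expectation (\<lambda>x. x\<^sup>2) - 4 * J * F.expectation (\<lambda>h. push_up J n h + push_down J n h)
    + F.expectation (boundary_error J n)"
proof -
  have h2: "integrable field (\<lambda>h. (h (Suc n))\<^sup>2)" "F.expectation (\<lambda>h. (h (Suc n))\<^sup>2) = expectation (\<lambda>x. x\<^sup>2)"
    using integrable_site[of "Suc n" "\<lambda>x. x\<^sup>2"] expectation_site[of "Suc n" "\<lambda>x. x\<^sup>2"]
      integrable_site_power(2)[of 2] by simp_all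
  have lin: "F.expectation (\<lambda>h. f1 h + 4 * f2 h + 4 * f3 h - 4 * J * f4 h + f5 h) =
      F.expectation f1 + 4 * F.expectation f2 + 4 * F.expectation f3 - 4 * J * F.expectation f4 + F.expectation f5"
    if "integrable field f1" "integrable field f2" "integrable field f3" "integrable field f4" "integrable field f5"
    for f1 f2 f3 f4 f5 :: "(nat \<Rightarrow> real) \<Rightarrow> real"
    using that by simp
  have "F.expectation (\<lambda>h. (log_ratio J (Suc n) h)\<^sup>2) = F.expectation (\<lambda>h. (log_ratio J n h)\<^sup>2)
      + 4 * F.expectation (\<lambda>h. (h (Suc n))\<^sup>2)
      + 4 * F.expectation (\<lambda>h. h (Suc n) * (log_ratio J n h + push_up J n h - push_down J n h))
      - 4 * J * F.expectation (\<lambda>h. push_up J n h + push_down J n h) + F.expectation (boundary_error J n)"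
    unfolding log_ratio_Suc_square
    by (intro lin integrable_log_ratio_square integrable_site_times_past integrable_boundary_error
        Bochner_Integration.integrable_add integrable_push h2 J)
  then show ?thesis using h2 expectation_site_times_past[OF J, of n] by simp
qed

lemma expectation_boundary_error:
  assumes J: "0 \<le> J" and l: "0 < l"
  defines "K \<equiv> 9 * expectation (\<lambda>x. (1 + 2 * \<bar>x\<bar>) ^ 3)"
  shows "\<bar>F.expectation (boundary_error J n)\<bar> \<le> l * F.expectation (\<lambda>h. push_up J n h + push_down J n h) + K / l"
proof -
  have i1: "integrable field (\<lambda>h. push_up J n h + push_down J n h)"
    using integrable_push[OF J, of n] by simp
  have i2: "integrable field (\<lambda>h. (1 + overshoot n h) ^ 3)" by (intro integrable_overshoot) simp
  have "\<bar>F.expectation (boundary_error J n)\<bar> \<le> F.expectation (\<lambda>h. \<bar>boundary_error J n h\<bar>)"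
    by (rule integral_abs_bound)
  also have "\<dots> \<le> F.expectation (\<lambda>h. l * (push_up J n h + push_down J n h) + 9 * (1 + overshoot n h) ^ 3 / l)"
    using i1 i2 integrable_boundary_error[OF J, of n]
    by (intro integral_mono boundary_error_bound[OF J l]) auto
  also have "\<dots> = l * F.expectation (\<lambda>h. push_up J n h + push_down J n h)
      + 9 * F.expectation (\<lambda>h. (1 + overshoot n h) ^ 3) / l"
    using i1 i2 by (subst Bochner_Integration.integral_add) auto
  also have "\<dots> \<le> l * F.expectation (\<lambda>h. push_up J n h + push_down J n h) + K / l"
    unfolding K_def using expectation_overshoot[of 3 n] l by (intro add_mono divide_right_mono) auto
  finally show ?thesis .
qed

lemma integrable_log_geom:
  assumes J: "0 \<le> J"
  shows "integrable field (log_geom J n)"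
proof (induction n)
  case (Suc n)
  have "log_geom J (Suc n) = (\<lambda>h. log_geom J n h + (push_up J n h + push_down J n h) / 2)"
    by (rule ext) (rule log_geom_Suc)
  then show ?case using Suc integrable_push[OF J, of n] by simp
next
  case 0
  have "log_geom J 0 = (\<lambda>h. 0)" by (rule ext) simp
  then show ?case by simp
qed

lemma expectation_log_geom_Suc:
  assumes J: "0 \<le> J"
  shows "2 * F.expectation (log_geom J (Suc n)) =
    2 * F.expectation (log_geom J n) + F.expectation (\<lambda>h. push_up J n h + push_down J n h)"
proof -
  have "F.expectation (log_geom J (Suc n)) =
      F.expectation (\<lambda>h. log_geom J n h + (push_up J n h + push_down J n h) / 2)"
    by (intro Bochner_Integration.integral_cong refl log_geom_Suc)
  also have "\<dots> = F.expectation (log_geom J n) + F.expectation (\<lambda>h. push_up J n h + push_down J n h) / 2"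
    using integrable_log_geom[OF J, of n] integrable_push[OF J, of n]
    by (subst Bochner_Integration.integral_add) auto
  finally show ?thesis by simp
qed

text \<open>The one-step identities are summed. As \<open>log_geom\<close> grows in mean by d / 2
  per step, the expected local times d add up to twice its mean, so the main term 4 J d and the
  error l d both turn into multiples of it. The parameter l stays free for a later choice.\<close>

lemma log_geom_balance:
  assumes J: "0 \<le> J" and l: "0 < l"
  defines "K \<equiv> 9 * expectation (\<lambda>x. (1 + 2 * \<bar>x\<bar>) ^ 3)"
  shows "\<bar>F.expectation (\<lambda>h. (log_ratio J n h)\<^sup>2) + 8 * J * F.expectation (log_geom J n)
      - 4 * real n * expectation (\<lambda>x. x\<^sup>2)\<bar> \<le> 2 * l * F.expectation (log_geom J n) + real n * (K / l)"
proof (induction n)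
  case (Suc n)
  define d where "d = F.expectation (\<lambda>h. push_up J n h + push_down J n h)"
  have g: "2 * F.expectation (log_geom J (Suc n)) = 2 * F.expectation (log_geom J n) + d"
    unfolding d_def by (rule expectation_log_geom_Suc[OF J])
  then have g': "8 * J * F.expectation (log_geom J (Suc n)) = 8 * J * F.expectation (log_geom J n) + 4 * J * d"
    "2 * l * F.expectation (log_geom J (Suc n)) = 2 * l * F.expectation (log_geom J n) + l * d"
    by algebra+
  have "\<bar>F.expectation (boundary_error J n)\<bar> \<le> l * d + K / l"
    unfolding d_def K_def by (rule expectation_boundary_error[OF J l])
  moreover have "F.expectation (\<lambda>h. (log_ratio J (Suc n) h)\<^sup>2) = F.expectation (\<lambda>h. (log_ratio J n h)\<^sup>2)
    + 4 * expectation (\<lambda>x. x\<^sup>2) - 4 * J * d + F.expectation (boundary_error J n)"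
    unfolding d_def by (rule expectation_log_ratio_Suc_square[OF J])
  moreover have "real (Suc n) * (K / l) = real n * (K / l) + K / l"
    "4 * real (Suc n) * expectation (\<lambda>x. x\<^sup>2) = 4 * real n * expectation (\<lambda>x. x\<^sup>2) + 4 * expectation (\<lambda>x. x\<^sup>2)"
    by (simp_all add: algebra_simps add_divide_distrib)
  ultimately show ?case using Suc g' by linarith
qed simp

text \<open>The logarithms of both entries differ from \<open>log_total\<close> by an amount bounded
  in mean uniformly in n, so the two expectations have the same limit per site.\<close>

lemma expectation_log_geom_tendsto:
  assumes J: "0 \<le> J"
  shows "(\<lambda>n. F.expectation (log_geom J n) / real n) \<longlonglongrightarrow> free_energy \<mu> J"
proof -
  define e where "e = exp (- 2 * J)"
  have e: "0 < e" "e \<le> 1" using J by (auto simp: e_def)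
  define D where "D = ln ((1 + e) / e) + ln (2 / e) + 1 + 2 * expectation (\<lambda>x. \<bar>x\<bar>)"
  have D: "\<bar>F.expectation (log_geom J n) - F.expectation (log_total e n)\<bar> \<le> D" if "0 < n" for n
  proof -
    have abs: "integrable field (\<lambda>h. \<bar>h n\<bar>)" "F.expectation (\<lambda>h. \<bar>h n\<bar>) = expectation (\<lambda>x. \<bar>x\<bar>)"
      using that integrable_site[of n "\<lambda>x. \<bar>x\<bar>"] expectation_site[of n "\<lambda>x. \<bar>x\<bar>"] integrable_site_power(2)[of 1]
      by auto
    have i: "integrable field (log_geom J n)" "integrable field (log_total e n)"
      by (rule integrable_log_geom[OF J], rule integrable_log_total[OF e])
    have "\<bar>F.expectation (log_geom J n) - F.expectation (log_total e n)\<bar> =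
        \<bar>F.expectation (\<lambda>h. log_geom J n h - log_total e n h)\<bar>"
      using i by simp
    also have "\<dots> \<le> F.expectation (\<lambda>h. \<bar>log_geom J n h - log_total e n h\<bar>)"
      by (rule integral_abs_bound)
    also have "\<dots> \<le> F.expectation (\<lambda>h. ln ((1 + e) / e) + ln (2 / e) + 1 + 2 * \<bar>h n\<bar>)"
      using i abs log_geom_near_log_total[OF J that, folded e_def] by (intro integral_mono) auto
    also have "\<dots> = D" using abs by (simp add: D_def F.prob_space)
    finally show ?thesis .
  qed
  have "(\<lambda>n. F.expectation (log_geom J n) / real n - F.expectation (log_total e n) / real n) \<longlonglongrightarrow> 0"
  proof (rule Lim_null_comparison)
    show "\<forall>\<^sub>F n in sequentially. norm (F.expectation (log_geom J n) / real n - F.expectation (log_total e n) / real n)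
        \<le> D / real n"
      using eventually_gt_at_top[of 0]
      by eventually_elim (use D in \<open>simp add: divide_right_mono abs_divide flip: diff_divide_distrib\<close>)
  qed (rule lim_const_over_n)
  from tendsto_add[OF this expectation_log_total_tendsto[OF J, folded e_def]] show ?thesis by simp
qed

text \<open>The summed balance is divided by n; the bounded second moment of the walk vanishes in
  the limit and only the free energy remains.\<close>

lemma free_energy_balance:
  assumes J: "0 \<le> J" and l: "0 < l"
  defines "K \<equiv> 9 * expectation (\<lambda>x. (1 + 2 * \<bar>x\<bar>) ^ 3)"
  shows "\<bar>8 * J * free_energy \<mu> J - 4 * expectation (\<lambda>x. x\<^sup>2)\<bar> \<le> 2 * l * free_energy \<mu> J + K / l"
proof -
  define G where "G = (\<lambda>n. F.expectation (log_geom J n) / real n)"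
  define C where "C = (2 * J + 1)\<^sup>2 * expectation (\<lambda>x. (1 + 2 * \<bar>x\<bar>)\<^sup>2)"
  have G: "G \<longlonglongrightarrow> free_energy \<mu> J"
    unfolding G_def by (rule expectation_log_geom_tendsto[OF J])
  show ?thesis
  proof (rule tendsto_le)
    show "(\<lambda>n. \<bar>8 * J * G n - 4 * expectation (\<lambda>x. x\<^sup>2)\<bar>) \<longlonglongrightarrow>
        \<bar>8 * J * free_energy \<mu> J - 4 * expectation (\<lambda>x. x\<^sup>2)\<bar>"
      by (intro tendsto_intros G)
    have "(\<lambda>n. 2 * l * G n + K / l + C / real n) \<longlonglongrightarrow> 2 * l * free_energy \<mu> J + K / l + 0"
      by (intro tendsto_intros G lim_const_over_n)
    then show "(\<lambda>n. 2 * l * G n + K / l + C / real n) \<longlonglongrightarrow> 2 * l * free_energy \<mu> J + K / l" by simp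
    show "\<forall>\<^sub>F n in sequentially. \<bar>8 * J * G n - 4 * expectation (\<lambda>x. x\<^sup>2)\<bar> \<le> 2 * l * G n + K / l + C / real n"
      using eventually_gt_at_top[of 0]
    proof eventually_elim
      fix n :: nat assume n: "0 < n"
      let ?g = "F.expectation (log_geom J n)" and ?v = "expectation (\<lambda>x. x\<^sup>2)"
      have "0 \<le> F.expectation (\<lambda>h. (log_ratio J n h)\<^sup>2)" by (simp add: integral_nonneg_AE)
      then have "\<bar>8 * J * ?g - 4 * real n * ?v\<bar> \<le> 2 * l * ?g + real n * (K / l) + C"
        using log_geom_balance[OF J l, of n, folded K_def] expectation_log_ratio_square[OF J, of n, folded C_def]
        by linarith
      then have "\<bar>8 * J * ?g - 4 * real n * ?v\<bar> / real n \<le> (2 * l * ?g + real n * (K / l) + C) / real n"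
        by (intro divide_right_mono) auto
      moreover have "(2 * l * ?g + real n * (K / l) + C) / real n = 2 * l * G n + K / l + C / real n"
        using n by (simp add: G_def add_divide_distrib)
      moreover have "\<bar>8 * J * ?g - 4 * real n * ?v\<bar> / real n = \<bar>(8 * J * ?g - 4 * real n * ?v) / real n\<bar>"
        by simp
      moreover have "(8 * J * ?g - 4 * real n * ?v) / real n = 8 * J * G n - 4 * ?v"
        using n by (simp add: G_def diff_divide_distrib)
      ultimately show "\<bar>8 * J * G n - 4 * ?v\<bar> \<le> 2 * l * G n + K / l + C / real n" by simp
    qed
  qed simp
qed

theorem free_energy_asymptotics:
  obtains B where "\<And>J. 1 \<le> J \<Longrightarrow>
    \<bar>free_energy \<mu> J - expectation (\<lambda>x. x\<^sup>2) / (2 * J)\<bar> \<le> B / J powr (3 / 2)"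
proof
  define v where "v = expectation (\<lambda>x. x\<^sup>2)"
  define K where "K = 9 * expectation (\<lambda>x. (1 + 2 * \<bar>x\<bar>) ^ 3)"
  have K: "0 \<le> K" unfolding K_def by (simp add: integral_nonneg_AE)
  have v: "0 \<le> v" unfolding v_def by (simp add: integral_nonneg_AE)
  fix J :: real assume J: "1 \<le> J"
  let ?F = "free_energy \<mu> J"
  have bal: "\<bar>8 * J * ?F - 4 * v\<bar> \<le> 2 * l * ?F + K / l" if "0 < l" for l
    using free_energy_balance[OF _ that, of J] J unfolding v_def K_def by simp
  \<comment> \<open>First choice l = J: the error 2 J F is absorbed by the main term 8 J F, which
    gives the a priori bound 6 J F <= 4 v + K.\<close>
  have "K / J \<le> K" using J K by (simp add: divide_le_eq mult_right_le_one_le mult_le_cancel_left1)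
  then have "6 * (J * ?F) \<le> 4 * v + K" using bal[of J] J by (simp add: abs_le_iff)
  then have F: "J * ?F \<le> v + K" using v K by linarith
  \<comment> \<open>Second choice l = sqrt J: by the a priori bound the errors 2 l F and K / l are
    now both of order 1 / sqrt J.\<close>
  define s where "s = sqrt J"
  have s: "0 < s" "s * s = J" using J by (auto simp: s_def)
  have "2 * s * ?F = 2 * (J * ?F) / s" using s by (simp add: field_simps flip: s(2))
  also have "\<dots> \<le> 2 * (v + K) / s" using F s by (intro divide_right_mono) auto
  finally have "\<bar>8 * J * ?F - 4 * v\<bar> \<le> 2 * (v + K) / s + K / s" using bal[OF s(1)] by linarith
  also have "\<dots> = (2 * v + 3 * K) / s" by (simp add: add_divide_distrib[symmetric])
  finally have "\<bar>8 * J * ?F - 4 * v\<bar> / (8 * J) \<le> (2 * v + 3 * K) / s / (8 * J)"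
    using J by (intro divide_right_mono) auto
  moreover have "\<bar>8 * J * ?F - 4 * v\<bar> / (8 * J) = \<bar>?F - v / (2 * J)\<bar>"
  proof -
    have "8 * J * ?F - 4 * v = (8 * J) * (?F - v / (2 * J))" using J by (simp add: field_simps)
    then show ?thesis using J by (simp add: abs_mult)
  qed
  moreover have "J powr (3 / 2) = s * J"
    using J powr_add[of J "1 / 2" 1] by (simp add: s_def powr_half_sqrt)
  ultimately show "\<bar>?F - expectation (\<lambda>x. x\<^sup>2) / (2 * J)\<bar> \<le> ((2 * v + 3 * K) / 8) / J powr (3 / 2)"
    unfolding v_def[symmetric] by (simp add: field_simps)
qed

end

section \<open>From exponential moments to the stated error term\<close>

text \<open>The inequality y <= exp y at y = t |x| / 4 gives, after taking fourth powers, a bound by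
  exp (t |x|), which is at most the sum of the two integrable exponentials.\<close>

lemma (in finite_measure) integrable_power4_of_exp:
  fixes X :: "'a \<Rightarrow> real"
  assumes [measurable]: "X \<in> borel_measurable M" and t: "0 < t"
    and int: "integrable M (\<lambda>\<omega>. exp (t * X \<omega>))" "integrable M (\<lambda>\<omega>. exp (- t * X \<omega>))"
  shows "integrable M (\<lambda>\<omega>. X \<omega> ^ 4)"
proof (rule Bochner_Integration.integrable_bound)
  show "integrable M (\<lambda>\<omega>. (4 / t) ^ 4 * (exp (t * X \<omega>) + exp (- t * X \<omega>)))"
    using int by (intro integrable_mult_right Bochner_Integration.integrable_add)
  have "x ^ 4 \<le> (4 / t) ^ 4 * (exp (t * x) + exp (- t * x))" for x
  proof -
    have "t * \<bar>x\<bar> / 4 \<le> exp (t * \<bar>x\<bar> / 4)" using exp_ge_add_one_self[of "t * \<bar>x\<bar> / 4"] by linarith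
    then have "(t * \<bar>x\<bar> / 4) ^ 4 \<le> exp (t * \<bar>x\<bar> / 4) ^ 4" using t by (intro power_mono) auto
    also have "\<dots> = exp (t * \<bar>x\<bar>)" by (simp flip: exp_of_nat_mult)
    also have "\<dots> \<le> exp (t * x) + exp (- t * x)" by (cases "0 \<le> x") auto
    finally have "(4 / t) ^ 4 * (t * \<bar>x\<bar> / 4) ^ 4 \<le> (4 / t) ^ 4 * (exp (t * x) + exp (- t * x))"
      using t by (intro mult_left_mono) auto
    moreover have "(4 / t) ^ 4 * (t * \<bar>x\<bar> / 4) ^ 4 = x ^ 4"
      unfolding power_mult_distrib[symmetric] using t by (simp add: power_even_abs)
    ultimately show ?thesis by simp
  qed
  then show "AE \<omega> in M. norm (X \<omega> ^ 4) \<le> norm ((4 / t) ^ 4 * (exp (t * X \<omega>) + exp (- t * X \<omega>)))"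
    by (auto intro!: AE_I2 order_trans[OF _ abs_ge_self])
qed simp

theorem theorem2:
  fixes \<mu> :: "real measure"
  assumes law: "real_distribution \<mu>"
    and centered: "prob_space.expectation \<mu> (\<lambda>x. x) = 0"
    and nontrivial: "\<mu> \<noteq> return borel 0"
    and exp_moments: "\<forall>\<^sub>F t in nhds 0. integrable \<mu> (\<lambda>x. exp (t * x))"
  shows "(\<lambda>J. free_energy \<mu> J - prob_space.variance \<mu> (\<lambda>x. x) / (2 * J))
           \<in> O[at_top](\<lambda>J. ln J powr (1 / 3) / J powr (4 / 3))"
proof -
  interpret \<mu>: real_distribution \<mu> by (rule law)
  obtain d where d: "0 < d" "\<And>t. dist t 0 < d \<Longrightarrow> integrable \<mu> (\<lambda>x. exp (t * x))"
    using exp_moments by (auto simp: eventually_nhds_metric)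
  \<comment> \<open>Half the radius d is taken so that both exponents d / 2 and - d / 2 lie inside
    the neighbourhood of 0.\<close>
  have "integrable \<mu> (\<lambda>x. x ^ 4)"
    using d(1) d(2)[of "d / 2"] d(2)[of "- (d / 2)"]
    by (intro \<mu>.integrable_power4_of_exp[where t = "d / 2"]) auto
  with centered interpret centered_law \<mu> by unfold_locales
  obtain B where B: "\<And>J. 1 \<le> J \<Longrightarrow>
      \<bar>free_energy \<mu> J - \<mu>.expectation (\<lambda>x. x\<^sup>2) / (2 * J)\<bar> \<le> B / J powr (3 / 2)"
    using free_energy_asymptotics by blast
  show ?thesis
  proof (rule bigoI)
    show "\<forall>\<^sub>F J in at_top. norm (free_energy \<mu> J - \<mu>.variance (\<lambda>x. x) / (2 * J))
        \<le> \<bar>B\<bar> * norm (ln J powr (1 / 3) / J powr (4 / 3))"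
      \<comment> \<open>From J = exp 1 on, ln J is at least 1, so the rate J^(-3/2) is dominated by
        the claimed one.\<close>
      using eventually_ge_at_top[of "exp 1"]
    proof eventually_elim
      fix J :: real assume J: "exp 1 \<le> J"
      have "1 \<le> exp (1::real)" by simp
      with J have J1: "1 \<le> J" by linarith
      have "ln (exp 1) \<le> ln J" using J J1 by (intro ln_mono) auto
      then have "1 \<le> ln J powr (1 / 3)" by (simp add: ge_one_powr_ge_zero)
      moreover have "J powr (4 / 3) \<le> J powr (3 / 2)" using J1 by (intro powr_mono) auto
      ultimately have "1 / J powr (3 / 2) \<le> ln J powr (1 / 3) / J powr (4 / 3)"
        using J1 by (intro frac_le) auto
      then have "\<bar>B\<bar> * (1 / J powr (3 / 2)) \<le> \<bar>B\<bar> * (ln J powr (1 / 3) / J powr (4 / 3))"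
        by (intro mult_left_mono) auto
      moreover have "B / J powr (3 / 2) \<le> \<bar>B\<bar> * (1 / J powr (3 / 2))" by (simp add: divide_right_mono)
      ultimately show "norm (free_energy \<mu> J - \<mu>.variance (\<lambda>x. x) / (2 * J))
        \<le> \<bar>B\<bar> * norm (ln J powr (1 / 3) / J powr (4 / 3))"
        \<comment> \<open>Since the mean is 0, the variance is the second moment.\<close>
        using B[OF J1] mean_zero by simp
    qed
  qed
qed

end
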